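(* Consider the quadrotor dynamics with the position tracking controller (thrust magnitude $f$ and moment vector $M$) described in the context. Suppose that the initial conditions satisfy $$\Psi(R(0),R_c(0))<1,\qquad \|e_x(0)\|<e_{x_{\max}},$$ for a fixed constant $e_{x_{\max}}$. Define $W_1,W_{12},W_2\in\mathbb{R}^{2\times2}$ by $$W_1=\begin{bmatrix}\frac{c_1k_x}{m}(1-\alpha)&-\frac{c_1k_v}{2m}(1+\alpha)\\-\frac{c_1k_v}{2m}(1+\alpha)&k_v(1-\alpha)-c_1\end{bmatrix},\quad W_{12}=\begin{bmatrix}\frac{c_1}{m}B&0\\ B+k_xe_{x_{\max}}&0\end{bmatrix},\quad W_2=\begin{bmatrix}\frac{c_2k_R}{\lambda_M(J)}&-\frac{c_2k_\Omega}{2\lambda_m(J)}\\-\frac{c_2k_\Omega}{2\lambda_m(J)}&k_\Omega-c_2\end{bmatrix},$$ where $\Psi(R(0),R_c(0))<\psi_1<1$ and $\alpha=\sqrt{\psi_1(2-\psi_1)}$. For positive constants $k_x,k_v$, choose positive constants $c_1,c_2,k_R,k_\Omega$ such that $$c_1<\min\left\{k_v(1-\alpha),\ \frac{4mk_xk_v(1-\alpha)^2}{k_v^2(1+\alpha)^2+4mk_x(1-\alpha)},\ \sqrt{k_xm}\right\},$$ $$c_2<\min\left\{k_\Omega,\ \frac{4k_\Omega k_R\lambda_m(J)^2}{k_\Omega^2\lambda_M(J)+4k_R\lambda_m(J)^2},\ \sqrt{k_R\lambda_m(J)}\right\},$$ $$\lambda_m(W_2)>\frac{4\|W_{12}\|^2}{\lambda_m(W_1)}.$$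 Then the zero equilibrium of the closed loop tracking errors $(e_x,e_v,e_R,e_\Omega)=(0,0,0,0)$ is exponentially stable. A region of attraction is characterized by the two initial conditions displayed first, namely $\Psi(R(0),R_c(0))<1$ and $\|e_x(0)\|<e_{x_{\max}}$, together with $$\|e_\Omega(0)\|^2<\frac{2}{\lambda_M(J)}k_R\bigl(\psi_1-\Psi(R(0),R_c(0))\bigr),$$ $$\lambda_M(M_{12})\|z_1(0)\|^2+\lambda_M(M_{22}')\|z_2(0)\|^2<\frac12k_xe_{x_{\max}}^2,$$ where $z_1=[\|e_x\|,\|e_v\|]^T$, $z_2=[\|e_R\|,\|e_\Omega\|]^T\in\mathbb{R}^2$ and $$M_{12}=\frac12\begin{bmatrix}k_x&c_1\\c_1&m\end{bmatrix},\qquad M_{22}'=\frac12\begin{bmatrix}\frac{2k_R}{2-\psi_1}&c_2\\c_2&\lambda_M(J)\end{bmatrix}.$$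
   Context: Notation: $\mathsf{SO(3)}=\{R\in\mathbb{R}^{3\times3}\mid R^TR=I,\ \det R=1\}$; $\mathsf{S}^2$ is the unit sphere in $\mathbb{R}^3$; $e_3=[0;0;1]$. The hat map $\hat{\cdot}:\mathbb{R}^3\to\mathfrak{so}(3)$ is defined by $\hat xy=x\times y$ for all $x,y\in\mathbb{R}^3$; the vee map $^\vee$ is its inverse. $\lambda_m(\cdot)$, $\lambda_M(\cdot)$ denote the minimum and maximum eigenvalues of a matrix; $\|\cdot\|$ is the Euclidean norm of a vector and the induced 2-norm of a matrix. Quadrotor dynamics: with $x,v,\Omega\in\mathbb{R}^3$, $R\in\mathsf{SO(3)}$, mass $m>0$, gravitational acceleration $g>0$, and symmetric positive-definite inertia matrix $J\in\mathbb{R}^{3\times3}$, $$\dot x=v,\quad m\dot v=mge_3-fRe_3,\quad \dot R=R\hat\Omega,\quad J\dot\Omega+\Omega\times J\Omega=M,$$ where the controls are the thrust magnitude $f\in\mathbb{R}$ and the moment $M\in\mathbb{R}^3$. Position tracking controller: let $x_d(t)\in\mathbb{R}^3$ be a smooth position command, $e_x=x-x_d$, $e_v=v-\dot x_d$. For positive constants $k_x,k_v,k_R,k_\Omega$, $$f=(k_xe_x+k_ve_v+mge_3-m\ddot x_d)\cdot Re_3,$$ $$M=-k_Re_R-k_\Omega e_\Omega+\Omega\times J\Omega-J(\hat\Omega R^TR_c\Omega_c-R^TR_c\dot\Omega_c),$$ $$e_R=\tfrac12(R_c^TR-R^TR_c)^\vee,\qquad e_\Omega=\Omega-R^TR_c\Omega_c,$$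 where $R_c=[b_{1_c};\,b_{3_c}\times b_{1_c};\,b_{3_c}]\in\mathsf{SO(3)}$ (the listed vectors are the columns), $\hat\Omega_c=R_c^T\dot R_c$, $$b_{3_c}=-\frac{-k_xe_x-k_ve_v-mge_3+m\ddot x_d}{\|-k_xe_x-k_ve_v-mge_3+m\ddot x_d\|}\in\mathsf{S}^2,$$ and $b_{1_c}\in\mathsf{S}^2$ is selected to be orthogonal to $b_{3_c}$ (so that $R_c$, $\Omega_c$, $\dot\Omega_c$ are well defined). The attitude error function is $\Psi(R,R_c)=\frac12\mathrm{tr}[I-R_c^TR]$. Standing assumptions: $\|-k_xe_x-k_ve_v-mge_3+m\ddot x_d\|\ne0$, and the commanded acceleration is uniformly bounded so that $\|-mge_3+m\ddot x_d\|<B$ for a given positive constant $B$. Exponential stability of the zero equilibrium of an error variable $z$ refers to a bound $\|z(t)\|\le\alpha'\|z(0)\|e^{-\beta t}$ for all $t>0$, with constants $\alpha',\beta>0$; here $z=(e_x,e_v,e_R,e_\Omega)$. *)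

theory Defs
  imports "HOL-Analysis.Analysis"
begin

unbundle cross3_syntax

section \<open>Linear algebra\<close>

definition SO3 :: "(real ^ 3 ^ 3) set" where
  "SO3 = {R. transpose R ** R = mat 1 \<and> det R = 1}"

definition e3 :: "real ^ 3" where
  "e3 = vector [0, 0, 1]"

definition hat :: "real ^ 3 \<Rightarrow> real ^ 3 ^ 3" where
  "hat x = matrix (\<lambda>y. x \<times> y)"

text \<open>Only meaningful on skew-symmetric matrices, the range of the injective map \<^const>\<open>hat\<close>.\<close>

definition vee :: "real ^ 3 ^ 3 \<Rightarrow> real ^ 3" where
  "vee A = inv hat A"

definition symmetric_pos_def :: "real ^ 'n ^ 'n \<Rightarrow> bool" where
  "symmetric_pos_def A \<longleftrightarrow> transpose A = A \<and> (\<forall>y. y \<noteq> 0 \<longrightarrow> y \<bullet> (A *v y) > 0)"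

definition eigenvalues :: "real ^ 'n ^ 'n \<Rightarrow> real set" where
  "eigenvalues A = {c. \<exists>y. y \<noteq> 0 \<and> A *v y = c *\<^sub>R y}"

text \<open>These are only applied to symmetric matrices, whose set of real eigenvalues is finite
  and nonempty.\<close>

definition lambda_min :: "real ^ 'n ^ 'n \<Rightarrow> real" where
  "lambda_min A = Min (eigenvalues A)"

definition lambda_max :: "real ^ 'n ^ 'n \<Rightarrow> real" where
  "lambda_max A = Max (eigenvalues A)"

text \<open>The norm of the type \<^typ>\<open>real ^ 'n ^ 'm\<close> is the Frobenius norm, so the induced 2-norm has to
  be taken as the operator norm of the associated linear map.\<close>

definition norm2 :: "real ^ 'n ^ 'm \<Rightarrow> real" where
  "norm2 A = onorm ((*v) A)"


section \<open>Signals\<close>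

text \<open>Signals live on an interval \<open>[0, T)\<close> with \<open>0 < T \<le> \<infinity>\<close>. For \<open>0 \<le> t < T\<close> the filter
  \<open>at t within {0..}\<close> only sees times in \<open>[0, T)\<close>; the derivative is one-sided at \<open>t = 0\<close>.\<close>

definition time_differentiable :: "(real \<Rightarrow> 'a::real_normed_vector) \<Rightarrow> real \<Rightarrow> bool" where
  "time_differentiable f t \<longleftrightarrow> f differentiable (at t within {0..})"

definition time_deriv :: "(real \<Rightarrow> 'a::real_normed_vector) \<Rightarrow> real \<Rightarrow> 'a" where
  "time_deriv f t = vector_derivative f (at t within {0..})"

definition smooth_signal :: "(real \<Rightarrow> 'a::real_normed_vector) \<Rightarrow> bool" where
  "smooth_signal f \<longleftrightarrow> (\<forall>n. \<forall>t\<ge>0. time_differentiable ((time_deriv ^^ n) f) t)"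


section \<open>Quadrotor and position tracking controller\<close>

record quadrotor =
  mass :: real
  gravity :: real
  inertia :: "real ^ 3 ^ 3"
  k_x :: real
  k_v :: real
  k_R :: real
  k_Omega :: real
  x_d :: "real \<Rightarrow> real ^ 3"

text \<open>The heading \<open>b1c\<close> is a free design choice of the controller, subject only to the constraints
  imposed in \<open>closed_loop\<close> below; it is therefore carried along as a signal.\<close>

record trajectory =
  pos :: "real \<Rightarrow> real ^ 3"
  vel :: "real \<Rightarrow> real ^ 3"
  att :: "real \<Rightarrow> real ^ 3 ^ 3"
  angvel :: "real \<Rightarrow> real ^ 3"
  b1c :: "real \<Rightarrow> real ^ 3"

definition e_x :: "quadrotor \<Rightarrow> trajectory \<Rightarrow> real \<Rightarrow> real ^ 3" where
  "e_x Q s t = pos s t - x_d Q t"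

definition e_v :: "quadrotor \<Rightarrow> trajectory \<Rightarrow> real \<Rightarrow> real ^ 3" where
  "e_v Q s t = vel s t - time_deriv (x_d Q) t"

definition feedforward :: "quadrotor \<Rightarrow> real \<Rightarrow> real ^ 3" where
  "feedforward Q t =
     - ((mass Q * gravity Q) *\<^sub>R e3) + mass Q *\<^sub>R time_deriv (time_deriv (x_d Q)) t"

definition desired_force :: "quadrotor \<Rightarrow> trajectory \<Rightarrow> real \<Rightarrow> real ^ 3" where
  "desired_force Q s t =
     - (k_x Q *\<^sub>R e_x Q s t) - k_v Q *\<^sub>R e_v Q s t + feedforward Q t"

definition b3c :: "quadrotor \<Rightarrow> trajectory \<Rightarrow> real \<Rightarrow> real ^ 3" where
  "b3c Q s t = - (desired_force Q s t /\<^sub>R norm (desired_force Q s t))"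

text \<open>\<^const>\<open>vector\<close> lists rows, whereas the three vectors are the columns of \<open>R_c\<close>.\<close>

definition R_c :: "quadrotor \<Rightarrow> trajectory \<Rightarrow> real \<Rightarrow> real ^ 3 ^ 3" where
  "R_c Q s t = transpose (vector [b1c s t, b3c Q s t \<times> b1c s t, b3c Q s t])"

definition Omega_c :: "quadrotor \<Rightarrow> trajectory \<Rightarrow> real \<Rightarrow> real ^ 3" where
  "Omega_c Q s t = vee (transpose (R_c Q s t) ** time_deriv (R_c Q s) t)"

definition e_R :: "quadrotor \<Rightarrow> trajectory \<Rightarrow> real \<Rightarrow> real ^ 3" where
  "e_R Q s t = (1 / 2) *\<^sub>R
     vee (transpose (R_c Q s t) ** att s t - transpose (att s t) ** R_c Q s t)"

definition e_Omega :: "quadrotor \<Rightarrow> trajectory \<Rightarrow> real \<Rightarrow> real ^ 3" where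
  "e_Omega Q s t = angvel s t - (transpose (att s t) ** R_c Q s t) *v Omega_c Q s t"

definition Psi :: "real ^ 3 ^ 3 \<Rightarrow> real ^ 3 ^ 3 \<Rightarrow> real" where
  "Psi R Rc = (1 / 2) * trace (mat 1 - transpose Rc ** R)"

definition thrust :: "quadrotor \<Rightarrow> trajectory \<Rightarrow> real \<Rightarrow> real" where
  "thrust Q s t =
     (k_x Q *\<^sub>R e_x Q s t + k_v Q *\<^sub>R e_v Q s t + (mass Q * gravity Q) *\<^sub>R e3
        - mass Q *\<^sub>R time_deriv (time_deriv (x_d Q)) t) \<bullet> (att s t *v e3)"

definition moment :: "quadrotor \<Rightarrow> trajectory \<Rightarrow> real \<Rightarrow> real ^ 3" where
  "moment Q s t =
     - (k_R Q *\<^sub>R e_R Q s t) - k_Omega Q *\<^sub>R e_Omega Q s t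
     + angvel s t \<times> (inertia Q *v angvel s t)
     - inertia Q *v
         ((hat (angvel s t) ** transpose (att s t) ** R_c Q s t) *v Omega_c Q s t
          - (transpose (att s t) ** R_c Q s t) *v time_deriv (Omega_c Q s) t)"

text \<open>\<open>s\<close> solves the closed-loop equations on \<open>[0, T)\<close>, and the commanded attitude is well defined
  there: the desired force does not vanish, \<open>b1c\<close> is a unit vector orthogonal to \<open>b3c\<close>, and the
  derivatives defining \<open>Omega_c\<close> and its rate exist.\<close>

definition closed_loop :: "quadrotor \<Rightarrow> ereal \<Rightarrow> trajectory \<Rightarrow> bool" where
  "closed_loop Q T s \<longleftrightarrow>
     (\<forall>t\<ge>0. ereal t < T \<longrightarrow>
        desired_force Q s t \<noteq> 0 \<and>
        norm (b1c s t) = 1 \<and> b1c s t \<bullet> b3c Q s t = 0 \<and>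
        time_differentiable (R_c Q s) t \<and> time_differentiable (Omega_c Q s) t \<and>
        att s t \<in> SO3 \<and>
        time_differentiable (pos s) t \<and> time_differentiable (vel s) t \<and>
        time_differentiable (att s) t \<and> time_differentiable (angvel s) t \<and>
        time_deriv (pos s) t = vel s t \<and>
        mass Q *\<^sub>R time_deriv (vel s) t =
          (mass Q * gravity Q) *\<^sub>R e3 - thrust Q s t *\<^sub>R (att s t *v e3) \<and>
        time_deriv (att s) t = att s t ** hat (angvel s t) \<and>
        inertia Q *v time_deriv (angvel s) t + angvel s t \<times> (inertia Q *v angvel s t) =
          moment Q s t)"


section \<open>Exponential stability\<close>

definition tracking_error ::
  "quadrotor \<Rightarrow> trajectory \<Rightarrow> real \<Rightarrow> (real ^ 3) \<times> (real ^ 3) \<times> (real ^ 3) \<times> (real ^ 3)" where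
  "tracking_error Q s t = (e_x Q s t, e_v Q s t, e_R Q s t, e_Omega Q s t)"

text \<open>The constants are uniform over all closed-loop solutions whose initial condition lies in \<open>D\<close>.
  Solutions on every interval \<open>[0, T)\<close> are covered, \<open>T = \<infinity>\<close> being the bound for all \<open>t > 0\<close>.\<close>

definition exponentially_stable_from :: "quadrotor \<Rightarrow> trajectory set \<Rightarrow> bool" where
  "exponentially_stable_from Q D \<longleftrightarrow>
     (\<exists>a b. 0 < a \<and> 0 < b \<and>
        (\<forall>T s. 0 < T \<and> closed_loop Q T s \<and> s \<in> D \<longrightarrow>
           (\<forall>t>0. ereal t < T \<longrightarrow>
              norm (tracking_error Q s t) \<le> a * norm (tracking_error Q s 0) * exp (- b * t))))"

text \<open>The bound on \<open>Psi\<close> cannot be dropped, since \<open>e_R\<close> also vanishes at the attitudes that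
  differ from \<open>R_c\<close> by a rotation through \<open>\<pi>\<close>, where \<open>Psi = 2\<close>.\<close>

definition zero_exponentially_stable :: "quadrotor \<Rightarrow> bool" where
  "zero_exponentially_stable Q \<longleftrightarrow>
     (\<exists>\<delta>>0. exponentially_stable_from Q
        {s. Psi (att s 0) (R_c Q s 0) < 1 \<and> norm (tracking_error Q s 0) < \<delta>})"


section \<open>Design matrices\<close>

definition alpha :: "real \<Rightarrow> real" where
  "alpha \<psi>1 = sqrt (\<psi>1 * (2 - \<psi>1))"

definition W1 :: "quadrotor \<Rightarrow> real \<Rightarrow> real \<Rightarrow> real ^ 2 ^ 2" where
  "W1 Q c1 \<psi>1 = vector
     [vector [c1 * k_x Q / mass Q * (1 - alpha \<psi>1),
              - (c1 * k_v Q / (2 * mass Q)) * (1 + alpha \<psi>1)],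
      vector [- (c1 * k_v Q / (2 * mass Q)) * (1 + alpha \<psi>1),
              k_v Q * (1 - alpha \<psi>1) - c1]]"

definition W12 :: "quadrotor \<Rightarrow> real \<Rightarrow> real \<Rightarrow> real \<Rightarrow> real ^ 2 ^ 2" where
  "W12 Q c1 B ex_max = vector
     [vector [c1 / mass Q * B, 0],
      vector [B + k_x Q * ex_max, 0]]"

definition W2 :: "quadrotor \<Rightarrow> real \<Rightarrow> real ^ 2 ^ 2" where
  "W2 Q c2 = vector
     [vector [c2 * k_R Q / lambda_max (inertia Q),
              - (c2 * k_Omega Q / (2 * lambda_min (inertia Q)))],
      vector [- (c2 * k_Omega Q / (2 * lambda_min (inertia Q))),
              k_Omega Q - c2]]"

definition M12 :: "quadrotor \<Rightarrow> real \<Rightarrow> real ^ 2 ^ 2" where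
  "M12 Q c1 = (1 / 2) *\<^sub>R vector
     [vector [k_x Q, c1],
      vector [c1, mass Q]]"

definition M22' :: "quadrotor \<Rightarrow> real \<Rightarrow> real \<Rightarrow> real ^ 2 ^ 2" where
  "M22' Q c2 \<psi>1 = (1 / 2) *\<^sub>R vector
     [vector [2 * k_R Q / (2 - \<psi>1), c2],
      vector [c2, lambda_max (inertia Q)]]"

definition z1 :: "quadrotor \<Rightarrow> trajectory \<Rightarrow> real \<Rightarrow> real ^ 2" where
  "z1 Q s t = vector [norm (e_x Q s t), norm (e_v Q s t)]"

definition z2 :: "quadrotor \<Rightarrow> trajectory \<Rightarrow> real \<Rightarrow> real ^ 2" where
  "z2 Q s t = vector [norm (e_R Q s t), norm (e_Omega Q s t)]"

end

theory Submission
  imports Defs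
begin

text \<open>
  The attitude error alone has the Lyapunov function \<open>1/2 e_\<Omega> \<bullet> J e_\<Omega> + k_R \<Psi>\<close>, which keeps
  \<open>\<Psi> < \<psi>1\<close>; there \<open>|e_R|\<^sup>2 = \<Psi> (2 - \<Psi>)\<close> is at most \<open>\<alpha>\<^sup>2\<close> and bounds the force with which
  the tilt perturbs the translational dynamics. Adding cross terms \<open>c e_x \<bullet> e_v\<close> and
  \<open>c2 e_R \<bullet> e_\<Omega>\<close> gives a quadratic Lyapunov function for the complete error.

  The estimate of its derivative needs an a priori bound on \<open>|e_x|\<close>. The choice \<open>c = c1\<close> does not
  yield \<open>|e_x| < ex_max\<close> from \<open>V < 1/2 k_x ex_max\<^sup>2\<close>, because the cross term makes \<open>V\<close> smaller
  than \<open>1/2 k_x |e_x|\<^sup>2\<close>. With \<open>c = c1 / 2\<close>, however, \<open>V \<ge> 3/8 k_x |e_x|\<^sup>2\<close> confines \<open>e_x\<close> to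
  \<open>|e_x| < 2 ex_max\<close>, and since \<open>W1\<close> is affine in \<open>c\<close>, so that its least eigenvalue is at worst
  halved, the factor 4 in the hypothesis on \<open>W2\<close> leaves enough room for both losses.
\<close>

section \<open>Symmetric matrices\<close>

lemma symmetric_inner_commute:
  fixes A :: "real ^ 'n ^ 'n"
  assumes "transpose A = A"
  shows "x \<bullet> (A *v y) = (A *v x) \<bullet> y"
  by (metis assms dot_lmul_matrix vector_transpose_matrix)

text \<open>A zero of a nonnegative form is a minimum, so its gradient vanishes. Concretely, moving
  from \<open>y\<close> along \<open>u = A *v y\<close> changes the form by
  \<open>2 t |u|^2 + t^2 k\<close>, which is negative for small negative \<open>t\<close> unless
  \<open>u = 0\<close>.\<close>

lemma psd_quadratic_zero_imp_kernel:
  fixes A :: "real ^ 'n ^ 'n"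
  assumes sym: "transpose A = A"
    and psd: "\<And>z. z \<bullet> (A *v z) \<ge> 0"
    and zero: "y \<bullet> (A *v y) = 0"
  shows "A *v y = 0"
proof (rule ccontr)
  define u where "u = A *v y"
  assume "A *v y \<noteq> 0"
  then have pos: "u \<bullet> u > 0" by (simp add: u_def)
  define k where "k = u \<bullet> (A *v u)"
  have k: "k \<ge> 0" using psd by (simp add: k_def)
  have yu: "y \<bullet> (A *v u) = u \<bullet> u"
    using symmetric_inner_commute[OF sym] by (simp add: u_def)
  have quad: "(y + t *\<^sub>R u) \<bullet> (A *v (y + t *\<^sub>R u)) = 2 * t * (u \<bullet> u) + t\<^sup>2 * k" for t
    using zero yu
    by (simp add: matrix_vector_right_distrib matrix_vector_mult_scaleR inner_add_left
        inner_add_right k_def power2_eq_square algebra_simps flip: u_def)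
  have "0 \<le> 2 * t * (u \<bullet> u) + t\<^sup>2 * k" for t
    using psd[of "y + t *\<^sub>R u"] quad by simp
  \<comment> \<open>Dividing by \<open>k + 1\<close> rather than by the minimising \<open>k\<close>
    also covers \<open>k = 0\<close>.\<close>
  from this[of "- (u \<bullet> u) / (k + 1)"]
  have "0 \<le> (u \<bullet> u)\<^sup>2 * (k - 2 * (k + 1)) / (k + 1)\<^sup>2"
    using k by (simp add: power2_eq_square divide_simps) (simp add: algebra_simps)
  moreover have "(u \<bullet> u)\<^sup>2 * (k - 2 * (k + 1)) / (k + 1)\<^sup>2 < 0"
    using k pos by (intro divide_neg_pos mult_pos_neg) auto
  ultimately show False by simp
qed

text \<open>Eigenvectors of a symmetric matrix for distinct eigenvalues are orthogonal, and a
  pairwise orthogonal set is finite in finite dimension. Finiteness is what gives \<open>Min\<close>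
  and \<open>Max\<close> in \<open>lambda_min\<close> and \<open>lambda_max\<close> their
  meaning.\<close>

lemma finite_eigenvalues_symmetric:
  fixes A :: "real ^ 'n ^ 'n"
  assumes sym: "transpose A = A"
  shows "finite (eigenvalues A)"
proof -
  define v where "v c = (SOME y. y \<noteq> 0 \<and> A *v y = c *\<^sub>R y)" for c
  have v: "v c \<noteq> 0 \<and> A *v v c = c *\<^sub>R v c" if "c \<in> eigenvalues A" for c
    using that unfolding v_def eigenvalues_def mem_Collect_eq by (rule someI_ex)
  have orth: "v c \<bullet> v d = 0" if "c \<in> eigenvalues A" "d \<in> eigenvalues A" "c \<noteq> d" for c d
    using symmetric_inner_commute[OF sym, of "v c" "v d"] v that by simp
  have "inj_on v (eigenvalues A)"
    by (rule inj_onI) (metis orth v inner_eq_zero_iff)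
  moreover have "finite (v ` eigenvalues A)"
    by (rule pairwise_orthogonal_imp_finite) (auto simp: pairwise_def orthogonal_def intro: orth)
  ultimately show ?thesis using finite_imageD by blast
qed

text \<open>Rayleigh quotient argument: the form attains its minimum \<open>c\<close> on the unit
  sphere at some \<open>y\<close>. Then \<open>A - c I\<close> is positive semidefinite and its form
  vanishes at \<open>y\<close>, so \<open>y\<close> lies in its kernel.\<close>

lemma exists_least_eigenvalue:
  fixes A :: "real ^ 'n ^ 'n"
  assumes sym: "transpose A = A"
  shows "\<exists>c\<in>eigenvalues A. \<forall>z. c * (norm z)\<^sup>2 \<le> z \<bullet> (A *v z)"
proof -
  let ?S = "sphere (0 :: real ^ 'n) 1"
  have "axis undefined 1 \<in> ?S" by (simp add: norm_axis_1)
  then have ne: "?S \<noteq> {}" by blast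
  have cont: "continuous_on ?S (\<lambda>z. z \<bullet> (A *v z))"
    by (intro continuous_intros matrix_vector_mult_linear_continuous_on)
  obtain y where "y \<in> ?S" and "\<forall>z\<in>?S. y \<bullet> (A *v y) \<le> z \<bullet> (A *v z)"
    using continuous_attains_inf[OF compact_sphere ne cont] by blast
  then have y: "norm y = 1" "norm z = 1 \<Longrightarrow> y \<bullet> (A *v y) \<le> z \<bullet> (A *v z)" for z
    by auto
  define c where "c = y \<bullet> (A *v y)"
  have bound: "c * (norm z)\<^sup>2 \<le> z \<bullet> (A *v z)" for z
  proof (cases "z = 0")
    case False
    then have "c \<le> (z /\<^sub>R norm z) \<bullet> (A *v (z /\<^sub>R norm z))"
      unfolding c_def by (intro y) simp
    then have "c \<le> (z \<bullet> (A *v z)) / (norm z)\<^sup>2"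
      by (simp add: matrix_vector_mult_scaleR divide_inverse power2_eq_square mult_ac)
    then show ?thesis using False by (simp add: pos_le_divide_eq)
  qed simp
  define D where "D = A - c *\<^sub>R mat 1"
  have D: "D *v z = A *v z - c *\<^sub>R z" for z
    by (simp add: D_def matrix_vector_mult_diff_rdistrib scaleR_matrix_vector_assoc[symmetric])
  have "transpose D = D"
    using sym by (simp add: D_def transpose_def mat_def vec_eq_iff)
  moreover have "z \<bullet> (D *v z) \<ge> 0" for z
    using bound[of z] by (simp add: D inner_diff_right power2_norm_eq_inner)
  moreover have "y \<bullet> (D *v y) = 0"
    using y(1) by (simp add: D inner_diff_right c_def flip: power2_norm_eq_inner)
  ultimately have "D *v y = 0" by (rule psd_quadratic_zero_imp_kernel)
  then have "c \<in> eigenvalues A"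
    unfolding eigenvalues_def mem_Collect_eq using y(1) D[of y]
    by (intro exI[of _ y]) auto
  then show ?thesis using bound by blast
qed

lemma lambda_min_eigenvalue:
  assumes "transpose A = A"
  shows "lambda_min A \<in> eigenvalues A"
  unfolding lambda_min_def
  by (rule Min_in[OF finite_eigenvalues_symmetric[OF assms]]) (use exists_least_eigenvalue[OF assms] in blast)

lemma lambda_min_quadratic_form:
  assumes "transpose A = A"
  shows "lambda_min A * (norm z)\<^sup>2 \<le> z \<bullet> (A *v z)"
proof -
  obtain c where c: "c \<in> eigenvalues A" "c * (norm z)\<^sup>2 \<le> z \<bullet> (A *v z)"
    using exists_least_eigenvalue[OF assms] by blast
  have "lambda_min A \<le> c"
    unfolding lambda_min_def using finite_eigenvalues_symmetric[OF assms] c(1) by (rule Min_le)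
  then have "lambda_min A * (norm z)\<^sup>2 \<le> c * (norm z)\<^sup>2" by (rule mult_right_mono) simp
  with c(2) show ?thesis by linarith
qed

lemma matrix_vector_mult_uminus_left: "(- A) *v y = - (A *v (y :: real ^ 'n))"
  using matrix_vector_mult_diff_rdistrib[of 0 A y] by simp

lemma eigenvalues_uminus: "eigenvalues (- A) = uminus ` eigenvalues (A :: real ^ 'n ^ 'n)"
proof -
  have *: "- c \<in> eigenvalues (- B)" if "c \<in> eigenvalues B" for c and B :: "real ^ 'n ^ 'n"
    using that by (auto simp: eigenvalues_def matrix_vector_mult_uminus_left)
  show ?thesis
  proof (intro equalityI subsetI)
    fix c assume "c \<in> eigenvalues (- A)"
    from *[OF this] have "- c \<in> eigenvalues A" by simp
    then have "- (- c) \<in> uminus ` eigenvalues A" by (rule imageI)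
    then show "c \<in> uminus ` eigenvalues A" by simp
  next
    fix c assume "c \<in> uminus ` eigenvalues A"
    then show "c \<in> eigenvalues (- A)" using * by blast
  qed
qed

text \<open>The least eigenvalue of \<open>- A\<close> is the negative of an eigenvalue of
  \<open>A\<close>, which \<open>lambda_max A\<close> dominates.\<close>

lemma lambda_max_quadratic_form:
  fixes A :: "real ^ 'n ^ 'n"
  assumes sym: "transpose A = A"
  shows "z \<bullet> (A *v z) \<le> lambda_max A * (norm z)\<^sup>2"
proof -
  have sym': "transpose (- A) = - A"
    using sym by (simp add: transpose_def vec_eq_iff)
  obtain c where c: "c \<in> eigenvalues (- A)" "c * (norm z)\<^sup>2 \<le> z \<bullet> ((- A) *v z)"
    using exists_least_eigenvalue[OF sym'] by blast
  then have "- c \<in> eigenvalues A" unfolding eigenvalues_uminus by force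
  then have "- c \<le> lambda_max A"
    unfolding lambda_max_def using finite_eigenvalues_symmetric[OF sym] by (intro Max_ge)
  then have "(- c) * (norm z)\<^sup>2 \<le> lambda_max A * (norm z)\<^sup>2" by (rule mult_right_mono) simp
  moreover have "z \<bullet> (A *v z) \<le> (- c) * (norm z)\<^sup>2"
    using c(2) by (simp add: matrix_vector_mult_uminus_left)
  ultimately show ?thesis by linarith
qed

lemma lambda_min_pos:
  assumes "symmetric_pos_def A"
  shows "lambda_min A > 0"
proof -
  obtain y where y: "y \<noteq> 0" "A *v y = lambda_min A *\<^sub>R y"
    using lambda_min_eigenvalue assms by (force simp: symmetric_pos_def_def eigenvalues_def)
  have "0 < y \<bullet> (A *v y)" using assms y(1) by (simp add: symmetric_pos_def_def)
  then have "0 < lambda_min A * (norm y)\<^sup>2" using y(2) by (simp add: power2_norm_eq_inner)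
  then show ?thesis using y(1) by (simp add: zero_less_mult_iff)
qed

lemma lambda_min_le_lambda_max:
  fixes A :: "real ^ 'n ^ 'n"
  assumes "transpose A = A"
  shows "lambda_min A \<le> lambda_max A"
  using lambda_min_quadratic_form[OF assms, of "axis undefined 1"]
    lambda_max_quadratic_form[OF assms, of "axis undefined 1"]
  by (simp add: norm_axis_1)

text \<open>Positive definiteness excludes a kernel, and an injective linear endomap in finite
  dimension is onto. The solution \<open>p\<close> plays the role of the inverse matrix applied to
  \<open>y\<close> in the next two estimates.\<close>

lemma pos_def_solvable:
  fixes A :: "real ^ 'n ^ 'n"
  assumes "symmetric_pos_def A"
  obtains p where "A *v p = y"
proof -
  have "inj ((*v) A)"
  proof (rule injI, rule ccontr)
    fix x z assume *: "A *v x = A *v z" "x \<noteq> z"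
    then have "x - z \<noteq> 0" by simp
    then have "(x - z) \<bullet> (A *v (x - z)) > 0"
      using assms unfolding symmetric_pos_def_def by blast
    then show False using * by (simp add: matrix_vector_mult_diff_distrib)
  qed
  then have "surj ((*v) A)"
    by (simp add: linear_injective_imp_surjective)
  then show ?thesis using that by (metis surjD)
qed

text \<open>This bounds the form of the inverse matrix from below by
  \<open>1 / lambda_max A\<close>. It comes from evaluating the form of \<open>A\<close> at
  \<open>lambda_max A *\<^sub>R p - y\<close> and bounding the remaining
  \<open>y \<bullet> (A *v y)\<close> from above.\<close>

lemma pos_def_solution_inner_lower:
  fixes A :: "real ^ 'n ^ 'n"
  assumes pd: "symmetric_pos_def A" and p: "A *v p = y"
  shows "(norm y)\<^sup>2 / lambda_max A \<le> y \<bullet> p"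
proof -
  let ?l = "lambda_max A"
  have sym: "transpose A = A" using pd by (simp add: symmetric_pos_def_def)
  have l: "?l > 0" using lambda_min_pos[OF pd] lambda_min_le_lambda_max[OF sym] by simp
  define w where "w = ?l *\<^sub>R p - y"
  have "0 \<le> w \<bullet> (A *v w)"
    using pd by (cases "w = 0") (auto simp: symmetric_pos_def_def less_imp_le)
  also have "A *v w = ?l *\<^sub>R y - A *v y"
    by (simp add: w_def matrix_vector_mult_diff_distrib matrix_vector_mult_scaleR p)
  also have "w \<bullet> (?l *\<^sub>R y - A *v y) = ?l\<^sup>2 * (y \<bullet> p) - 2 * ?l * (y \<bullet> y) + y \<bullet> (A *v y)"
    using symmetric_inner_commute[OF sym, of p y] p
    by (simp add: w_def inner_diff_left inner_diff_right inner_commute[of y p] power2_eq_square algebra_simps)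
  finally have "0 \<le> ?l\<^sup>2 * (y \<bullet> p) - 2 * ?l * (y \<bullet> y) + ?l * (y \<bullet> y)"
    using lambda_max_quadratic_form[OF sym, of y] by (simp add: power2_norm_eq_inner)
  then have "?l * (y \<bullet> y) \<le> ?l * (?l * (y \<bullet> p))" by (simp add: power2_eq_square)
  then have "y \<bullet> y \<le> ?l * (y \<bullet> p)" using l by simp
  then show ?thesis using l by (simp add: divide_simps power2_norm_eq_inner mult.commute)
qed

lemma pos_def_solution_norm_upper:
  fixes A :: "real ^ 'n ^ 'n"
  assumes pd: "symmetric_pos_def A" and p: "A *v p = y"
  shows "norm p \<le> norm y / lambda_min A"
proof -
  have "lambda_min A * (norm p)\<^sup>2 \<le> norm p * norm y"
    using lambda_min_quadratic_form[of A p] pd p norm_cauchy_schwarz[of p y]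
    by (simp add: symmetric_pos_def_def)
  then have "lambda_min A * norm p \<le> norm y"
    by (cases "p = 0") (simp_all add: power2_eq_square)
  then show ?thesis using lambda_min_pos[OF pd] by (simp add: field_simps)
qed

section \<open>Quadratic forms in two variables\<close>

lemma sym2_quadratic_form:
  "(vector [a, b] :: real ^ 2) \<bullet> (vector [vector [p, q], vector [q, r]] *v (vector [a, b] :: real ^ 2)) =
     p * a\<^sup>2 + 2 * q * (a * b) + r * b\<^sup>2"
  by (simp add: inner_vec_def matrix_vector_mult_def sum_2 power2_eq_square algebra_simps)

lemma transpose_sym2: "transpose (vector [vector [p, q], vector [q, r]] :: real ^ 2 ^ 2) = vector [vector [p, q], vector [q, r]]"
  by (simp add: transpose_def vec_eq_iff forall_2)

lemma norm_vector2: "(norm (vector [a, b] :: real ^ 2))\<^sup>2 = a\<^sup>2 + b\<^sup>2"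
  by (simp add: norm_vec_def L2_set_def sum_2)

text \<open>Multiplication by \<open>p\<close> completes the square and leaves the determinant
  \<open>p * r - q^2\<close> as coefficient of \<open>b^2\<close>.\<close>

lemma quadratic_form2_pos:
  fixes p q r a b :: real
  assumes "p > 0" "q\<^sup>2 < p * r" "a \<noteq> 0 \<or> b \<noteq> 0"
  shows "p * a\<^sup>2 + 2 * q * (a * b) + r * b\<^sup>2 > 0"
proof -
  have "p * (p * a\<^sup>2 + 2 * q * (a * b) + r * b\<^sup>2) = (p * a + q * b)\<^sup>2 + (p * r - q\<^sup>2) * b\<^sup>2"
    by (simp add: power2_eq_square algebra_simps)
  moreover have "(p * a + q * b)\<^sup>2 + (p * r - q\<^sup>2) * b\<^sup>2 > 0"
  proof (cases "b = 0")
    case False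
    then show ?thesis using assms by (intro add_nonneg_pos) auto
  qed (use assms in auto)
  ultimately show ?thesis using assms(1) by (metis zero_less_mult_pos)
qed

lemma symmetric_pos_def_sym2:
  assumes "p > 0" "q\<^sup>2 < p * r"
  shows "symmetric_pos_def (vector [vector [p, q], vector [q, r]] :: real ^ 2 ^ 2)"
proof -
  have "y \<bullet> (vector [vector [p, q], vector [q, r]] *v y) > 0" if nz: "y \<noteq> 0" for y :: "real ^ 2"
  proof -
    obtain a b where y: "y = vector [a, b]"
      by (rule that[of "y $ 1" "y $ 2"]) (simp add: vec_eq_iff forall_2)
    have "a \<noteq> 0 \<or> b \<noteq> 0" using nz by (auto simp: y vec_eq_iff forall_2)
    then show ?thesis
      unfolding y sym2_quadratic_form using assms by (intro quadratic_form2_pos)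
  qed
  then show ?thesis by (simp add: symmetric_pos_def_def transpose_sym2)
qed


section \<open>Rotations\<close>

lemma SO3_iff_rotation_matrix: "P \<in> SO3 \<longleftrightarrow> rotation_matrix P"
  by (simp add: SO3_def rotation_matrix_def orthogonal_matrix)

lemma rotation_matrix_mul:
  fixes A B :: "real ^ 'n ^ 'n"
  shows "rotation_matrix A \<Longrightarrow> rotation_matrix B \<Longrightarrow> rotation_matrix (A ** B)"
  by (simp add: rotation_matrix_def orthogonal_matrix_mul det_mul)

lemma rotation_matrix_transpose:
  fixes A :: "real ^ 'n ^ 'n"
  shows "rotation_matrix A \<Longrightarrow> rotation_matrix (transpose A)"
  by (simp add: rotation_matrix_def det_transpose)

lemma hat_mult_vec: "hat x *v y = x \<times> y"
  using matrix_works[of "(\<times>) x"] bilinear_cross by (simp add: hat_def bilinear_def)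

lemma hat_explicit:
  "hat x = vector [vector [0, - x $ 3, x $ 2], vector [x $ 3, 0, - x $ 1], vector [- x $ 2, x $ 1, 0]]"
  by (simp add: hat_def matrix_def cross3_def vec_eq_iff forall_3 axis_def)

text \<open>\<open>vee\<close> is \<open>inv hat\<close> and thus inverts \<open>hat\<close> only on
  its range. Skew symmetry puts \<open>A\<close> into that range, and injectivity of
  \<open>hat\<close> makes the preimage unique.\<close>

lemma vee_skew:
  assumes "transpose A = - A"
  shows "hat (vee A) = A" and "vee A = vector [A $ 3 $ 2, A $ 1 $ 3, A $ 2 $ 1]"
proof -
  have inj: "inj hat"
    by (rule injI) (simp add: hat_explicit vec_eq_iff forall_3)
  have e: "A $ j $ i = - A $ i $ j" for i j
    using arg_cong[OF assms, of "\<lambda>B. B $ i $ j"] by (simp add: transpose_def)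
  have "A = hat (vector [A $ 3 $ 2, A $ 1 $ 3, A $ 2 $ 1])"
    using e[of 1 1] e[of 2 2] e[of 3 3] e[of 1 2] e[of 1 3] e[of 2 3]
    by (simp add: hat_explicit vec_eq_iff forall_3)
  moreover from this show "vee A = vector [A $ 3 $ 2, A $ 1 $ 3, A $ 2 $ 1]"
    unfolding vee_def using inv_f_f[OF inj] by metis
  ultimately show "hat (vee A) = A" by simp
qed

lemma vee_diff_transpose:
  "vee (P - transpose P) =
     vector [P $ 3 $ 2 - P $ 2 $ 3, P $ 1 $ 3 - P $ 3 $ 1, P $ 2 $ 1 - P $ 1 $ 2]"
proof -
  have "transpose (P - transpose P) = - (P - transpose P)"
    by (simp add: transpose_def vec_eq_iff)
  from vee_skew(2)[OF this] show ?thesis by (simp add: transpose_def)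
qed

text \<open>Since \<open>hat w\<close> is skew, the trace sees only the skew part of
  \<open>P\<close>. This identity turns the derivative of the attitude error function into an inner
  product with \<open>e_R\<close>.\<close>

lemma trace_mult_hat: "trace (P ** hat w) = - (w \<bullet> vee (P - transpose P))"
  unfolding vee_diff_transpose
  by (simp add: trace_def matrix_matrix_mult_def hat_explicit sum_3 inner_vec_def algebra_simps)

text \<open>Rotations preserve the cross product: with \<open>v = transpose P *v w\<close>, the
  product \<open>P *v (v \<times> y)\<close> equals \<open>(P *v v) \<times> (P *v y)\<close>, and
  \<open>P *v v = w\<close>.\<close>

lemma rotation_matrix_hat_conj:
  fixes P :: "real ^ 3 ^ 3"
  assumes "rotation_matrix P"
  shows "hat w ** P = P ** hat (transpose P *v w)"
proof -
  have "P *v (transpose P *v w) = w"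
    using assms unfolding rotation_matrix_def orthogonal_matrix_def matrix_vector_mul_assoc by simp
  then have "(hat w ** P) *v y = (P ** hat (transpose P *v w)) *v y" for y
    using cross_rotation_matrix[OF assms, of "transpose P *v w" y]
    by (simp add: hat_mult_vec flip: matrix_vector_mul_assoc)
  then show ?thesis by (simp add: matrix_eq)
qed

section \<open>Norm and trace inequalities for rotations\<close>

lemma rotation_matrix_norm:
  fixes P :: "real ^ 'n ^ 'n"
  assumes "rotation_matrix P"
  shows "norm (P *v x) = norm x"
proof -
  have "transpose P *v (P *v x) = x"
    using assms unfolding rotation_matrix_def orthogonal_matrix_def matrix_vector_mul_assoc by simp
  then have "(P *v x) \<bullet> (P *v x) = x \<bullet> x"
    by (simp flip: dot_lmul_matrix)
  then show ?thesis by (simp add: norm_eq)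
qed

text \<open>A rotation equals its own cofactor matrix, because it maps the cross product of two
  basis vectors to the cross product of two of its columns. The three identities are the diagonal
  entries of this equation.\<close>

lemma rotation_matrix_minors:
  fixes P :: "real ^ 3 ^ 3"
  assumes "rotation_matrix P"
  shows "P $ 2 $ 3 * P $ 3 $ 2 = P $ 2 $ 2 * P $ 3 $ 3 - P $ 1 $ 1"
    and "P $ 1 $ 3 * P $ 3 $ 1 = P $ 1 $ 1 * P $ 3 $ 3 - P $ 2 $ 2"
    and "P $ 1 $ 2 * P $ 2 $ 1 = P $ 1 $ 1 * P $ 2 $ 2 - P $ 3 $ 3"
proof -
  have "(P *v axis i 1) \<times> (P *v axis j 1) = P *v (axis i 1 \<times> axis j 1)" for i j :: 3
    by (rule cross_rotation_matrix[OF assms])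
  from this[of 2 3] this[of 3 1] this[of 1 2]
  show "P $ 2 $ 3 * P $ 3 $ 2 = P $ 2 $ 2 * P $ 3 $ 3 - P $ 1 $ 1"
    and "P $ 1 $ 3 * P $ 3 $ 1 = P $ 1 $ 1 * P $ 3 $ 3 - P $ 2 $ 2"
    and "P $ 1 $ 2 * P $ 2 $ 1 = P $ 1 $ 1 * P $ 2 $ 2 - P $ 3 $ 3"
    by (simp_all add: matrix_vector_mult_basis column_def cross3_simps vec_eq_iff forall_3
        matrix_vector_mult_def sum_3 axis_def)
qed

lemma rotation_matrix_sum_squares:
  fixes P :: "real ^ 3 ^ 3"
  assumes "rotation_matrix P"
  shows "(P $ 1 $ 1)\<^sup>2 + (P $ 2 $ 1)\<^sup>2 + (P $ 3 $ 1)\<^sup>2 + (P $ 1 $ 2)\<^sup>2 + (P $ 2 $ 2)\<^sup>2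
     + (P $ 3 $ 2)\<^sup>2 + (P $ 1 $ 3)\<^sup>2 + (P $ 2 $ 3)\<^sup>2 + (P $ 3 $ 3)\<^sup>2 = 3"
proof -
  have "(transpose P ** P) $ i $ i = 1" for i
    using assms by (simp add: rotation_matrix_def orthogonal_matrix_def mat_def)
  from this[of 1] this[of 2] this[of 3] show ?thesis
    by (simp add: matrix_matrix_mult_def transpose_def sum_3 power2_eq_square)
qed

text \<open>For a rotation through \<theta> both sides equal \<open>4 sin^2\<close> of \<theta>, as
  the trace is 1 + 2 cos \<theta>. The proof avoids the rotation angle: the squares of the entries
  sum to 3, and the cofactor identities express the products of opposite off-diagonal entries
  through diagonal ones.\<close>

lemma norm_vee_rotation:
  fixes P :: "real ^ 3 ^ 3"
  assumes "rotation_matrix P"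
  shows "(norm (vee (P - transpose P)))\<^sup>2 = (3 - trace P) * (1 + trace P)"
proof -
  have "(norm (vee (P - transpose P)))\<^sup>2 =
      ((P $ 1 $ 1)\<^sup>2 + (P $ 2 $ 1)\<^sup>2 + (P $ 3 $ 1)\<^sup>2 + (P $ 1 $ 2)\<^sup>2 + (P $ 2 $ 2)\<^sup>2
        + (P $ 3 $ 2)\<^sup>2 + (P $ 1 $ 3)\<^sup>2 + (P $ 2 $ 3)\<^sup>2 + (P $ 3 $ 3)\<^sup>2)
      - ((P $ 1 $ 1)\<^sup>2 + (P $ 2 $ 2)\<^sup>2 + (P $ 3 $ 3)\<^sup>2)
      - 2 * (P $ 2 $ 3 * P $ 3 $ 2 + P $ 1 $ 3 * P $ 3 $ 1 + P $ 1 $ 2 * P $ 2 $ 1)"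
    unfolding vee_diff_transpose power2_norm_eq_inner
    by (simp add: inner_vec_def sum_3 power2_eq_square algebra_simps)
  also have "\<dots> = (3 - trace P) * (1 + trace P)"
    unfolding rotation_matrix_minors[OF assms] rotation_matrix_sum_squares[OF assms]
    by (simp add: trace_def sum_3 power2_eq_square algebra_simps)
  finally show ?thesis .
qed

text \<open>The product \<open>(3 - trace P) * (1 + trace P)\<close> is a squared norm, so the trace
  lies between its roots.\<close>

lemma rotation_matrix_trace_bounds:
  fixes P :: "real ^ 3 ^ 3"
  assumes "rotation_matrix P"
  shows "- 1 \<le> trace P" and "trace P \<le> 3"
proof -
  have "0 \<le> (3 - trace P) * (1 + trace P)"
    using norm_vee_rotation[OF assms] by (metis zero_le_power2)
  then show "- 1 \<le> trace P" and "trace P \<le> 3"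
    by (auto simp: zero_le_mult_iff)
qed

text \<open>A rotation tilts the third axis by at most its rotation angle. Composing
  \<open>P\<close> with the half turn \<open>D\<close> about that axis gives a rotation of trace
  \<open>2 * P $ 3 $ 3 - trace P\<close>, which is at least -1.\<close>

lemma rotation_matrix_tilt_lower:
  fixes P :: "real ^ 3 ^ 3"
  assumes "rotation_matrix P"
  shows "(trace P - 1) / 2 \<le> P $ 3 $ 3"
proof -
  define D :: "real ^ 3 ^ 3" where
    "D = vector [vector [- 1, 0, 0], vector [0, - 1, 0], vector [0, 0, 1]]"
  have "transpose D ** D = mat 1"
    by (simp add: D_def transpose_def matrix_matrix_mult_def mat_def sum_3 vec_eq_iff forall_3)
  then have "rotation_matrix D"
    by (simp add: rotation_matrix_def orthogonal_matrix) (simp add: D_def det_3)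
  from rotation_matrix_trace_bounds(1)[OF rotation_matrix_mul[OF assms this]] show ?thesis
    by (simp add: D_def matrix_matrix_mult_def trace_def sum_3)
qed

text \<open>The left side is the trace of \<open>transpose (hat w) ** P ** hat w\<close>, a sum of
  values of the form of \<open>P\<close> at the vectors \<open>w \<times> axis i 1\<close>. A
  rotation cannot increase such a form beyond the squared lengths, and these add up to twice that of
  \<open>w\<close>.\<close>

lemma rotation_matrix_trace_quadratic:
  fixes P :: "real ^ 3 ^ 3"
  assumes "rotation_matrix P"
  shows "w \<bullet> vee (P ** hat w - transpose (P ** hat w)) \<le> 2 * (norm w)\<^sup>2"
proof -
  have le: "u \<bullet> (P *v u) \<le> u \<bullet> u" for u
    using norm_cauchy_schwarz[of u "P *v u"] rotation_matrix_norm[OF assms, of u]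
    by (simp flip: power2_norm_eq_inner add: power2_eq_square)
  have "w \<bullet> vee (P ** hat w - transpose (P ** hat w)) =
      (\<Sum>i\<in>UNIV. (w \<times> axis i 1) \<bullet> (P *v (w \<times> axis i 1)))"
    unfolding vee_diff_transpose
    by (simp add: sum_3 matrix_matrix_mult_def matrix_vector_mult_def hat_explicit inner_vec_def
        cross3_def axis_def algebra_simps)
  also have "\<dots> \<le> (\<Sum>i\<in>UNIV. (w \<times> axis i 1) \<bullet> (w \<times> axis i 1))"
    by (rule sum_mono) (rule le)
  also have "\<dots> = 2 * (norm w)\<^sup>2"
    unfolding power2_norm_eq_inner
    by (simp add: sum_3 inner_vec_def cross3_def axis_def algebra_simps)
  finally show ?thesis .
qed

lemma orthonormal_frame_rotation:
  assumes "norm b1 = 1" "norm b3 = 1" "b1 \<bullet> b3 = 0"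
  shows "rotation_matrix (transpose (vector [b1, b3 \<times> b1, b3]))"
proof -
  let ?A = "vector [b1, b3 \<times> b1, b3] :: real ^ 3 ^ 3"
  have b: "b1 \<bullet> b1 = 1" "b3 \<bullet> b3 = 1" using assms by (simp_all add: norm_eq_1)
  have n: "(b3 \<times> b1) \<bullet> (b3 \<times> b1) = 1"
    using dot_cross[of b3 b1 b3 b1] b assms(3) by (simp add: inner_commute)
  have o: "(b3 \<times> b1) \<bullet> b1 = 0" "(b3 \<times> b1) \<bullet> b3 = 0" "b1 \<bullet> (b3 \<times> b1) = 0" "b3 \<bullet> (b3 \<times> b1) = 0"
    by (simp_all add: dot_cross_self)
  have "?A ** transpose ?A = mat 1"
    using b n o assms(3)
    by (simp add: vec_eq_iff forall_3 matrix_mult_transpose_dot_row row_def mat_def inner_commute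
        vec_lambda_eta)
  moreover have "det ?A = (b3 \<times> b1) \<bullet> (b3 \<times> b1)"
    by (simp add: det_3 inner_vec_def sum_3 cross3_def algebra_simps)
  ultimately show ?thesis
    using n by (simp add: rotation_matrix_def orthogonal_matrix det_transpose)
qed

lemma hat_diff: "hat (x - y) = hat x - hat y"
  by (simp add: hat_explicit vec_eq_iff forall_3)

lemma transpose_hat: "transpose (hat x) = - hat x"
  by (simp add: hat_explicit transpose_def vec_eq_iff forall_3)


section \<open>Derivatives\<close>

lemma bounded_bilinear_matrix_mult:
  "bounded_bilinear ((**) :: real ^ 'n ^ 'm \<Rightarrow> real ^ 'k ^ 'n \<Rightarrow> real ^ 'k ^ 'm)"
  unfolding bilinear_conv_bounded_bilinear[symmetric] bilinear_def
  by (auto intro!: linearI simp: vec_eq_iff matrix_matrix_mult_def sum_distrib_left sum.distrib algebra_simps)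

lemma bounded_bilinear_matrix_vector_mult:
  "bounded_bilinear ((*v) :: real ^ 'n ^ 'm \<Rightarrow> real ^ 'n \<Rightarrow> real ^ 'm)"
  unfolding bilinear_conv_bounded_bilinear[symmetric] bilinear_def
  by (auto intro!: linearI simp: vec_eq_iff matrix_vector_mult_def sum_distrib_left sum.distrib algebra_simps)

lemma bounded_linear_transpose:
  "bounded_linear (transpose :: real ^ 'n ^ 'm \<Rightarrow> real ^ 'm ^ 'n)"
  unfolding linear_conv_bounded_linear[symmetric]
  by (auto intro!: linearI simp: transpose_def vec_eq_iff)

lemma bounded_linear_trace: "bounded_linear (trace :: real ^ 'n ^ 'n \<Rightarrow> real)"
  unfolding linear_conv_bounded_linear[symmetric]
  by (auto intro!: linearI simp: trace_def sum.distrib sum_distrib_left)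

lemma bounded_linear_vee_diff_transpose: "bounded_linear (\<lambda>P. vee (P - transpose P))"
  unfolding linear_conv_bounded_linear[symmetric] vee_diff_transpose
  by (auto intro!: linearI simp: vec_eq_iff forall_3 algebra_simps)

text \<open>Guarantees that the derivative within \<open>{0..}\<close> is unique, including the
  one-sided derivative at 0.\<close>

lemma at_within_atLeast_neq_bot: "0 \<le> t \<Longrightarrow> at t within {0..} \<noteq> (bot :: real filter)"
  using islimpt_subset[of t "{0..t + 1}" "{0..}"] islimpt_Icc[of 0 "t + 1" t]
  by (auto simp: trivial_limit_within)

lemma time_deriv_works:
  "time_differentiable f t \<longleftrightarrow> (f has_vector_derivative time_deriv f t) (at t within {0..})"
  unfolding time_differentiable_def time_deriv_def by (rule vector_derivative_works)

text \<open>Differentiating \<open>transpose A ** A = mat 1\<close> gives the claim. Orthogonality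
  is asked only near \<open>t\<close>, since a solution may exist only on a bounded
  interval.\<close>

lemma deriv_within_orthogonal_skew:
  assumes A: "(A has_vector_derivative A') (at t within {0..})" and t: "0 \<le> t" "0 < d"
    and orth: "\<And>u. 0 \<le> u \<Longrightarrow> dist u t < d \<Longrightarrow> orthogonal_matrix (A u :: real ^ 'n ^ 'n)"
  shows "transpose (transpose (A t) ** A') = - (transpose (A t) ** A')"
proof -
  have "((\<lambda>u. transpose (A u) ** A u) has_vector_derivative
      (transpose (A t) ** A' + transpose A' ** A t)) (at t within {0..})"
    by (intro bounded_bilinear.has_vector_derivative[OF bounded_bilinear_matrix_mult]
        bounded_linear.has_vector_derivative[OF bounded_linear_transpose] A)
  then have "((\<lambda>u. mat 1) has_vector_derivative
      (transpose (A t) ** A' + transpose A' ** A t)) (at t within {0..})"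
    by (rule has_vector_derivative_transform_within[OF _ t(2)])
      (use t orth in \<open>auto simp: orthogonal_matrix_def\<close>)
  from vector_derivative_unique_within[OF at_within_atLeast_neq_bot[OF t(1)] this
      has_vector_derivative_const]
  show ?thesis by (simp add: matrix_transpose_mul eq_neg_iff_add_eq_0 add.commute)
qed

section \<open>Barrier and decay arguments for real functions\<close>

lemma barrier_on_interval:
  fixes f :: "real \<Rightarrow> real"
  assumes cont: "continuous_on {0..t} f" and "0 \<le> t" and init: "f 0 < c"
    and step: "\<And>u. 0 < u \<Longrightarrow> u \<le> t \<Longrightarrow> (\<And>r. 0 \<le> r \<Longrightarrow> r < u \<Longrightarrow> f r < c) \<Longrightarrow> f u < c"
  shows "f t < c"
proof (rule ccontr)
  assume "\<not> f t < c"
  \<comment> \<open>The times of violation form a compact set. Its least element \<open>u\<close>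
    has no violation before it, so the step hypothesis applies there and contradicts
    membership.\<close>
  define S where "S = {u \<in> {0..t}. c \<le> f u}"
  have "closed S"
    unfolding S_def by (intro continuous_on_closed_Collect_le continuous_on_const cont closed_atLeastAtMost)
  moreover have "bounded S"
    unfolding S_def by (rule bounded_subset[of "{0..t}"]) auto
  ultimately have "compact S" by (simp add: compact_eq_bounded_closed)
  moreover have "S \<noteq> {}" using \<open>\<not> f t < c\<close> \<open>0 \<le> t\<close> by (auto simp: S_def)
  ultimately obtain u where u: "u \<in> S" "\<forall>r\<in>S. u \<le> r"
    using compact_attains_inf[of S] by blast
  have uS: "0 \<le> u" "u \<le> t" "c \<le> f u" using u(1) by (simp_all add: S_def)
  have "u \<noteq> 0" using uS(3) init by (metis not_less)
  then have pos: "0 < u" using uS(1) by simp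
  have below: "f r < c" if "0 \<le> r" "r < u" for r
  proof (rule ccontr)
    assume "\<not> f r < c"
    then have "r \<in> S" using uS that by (simp add: S_def)
    then show False using u(2) that(2) by (meson not_less)
  qed
  have "f u < c" by (rule step[OF pos uS(2)]) (rule below)
  then show False using uS(3) by simp
qed

text \<open>The product \<open>exp (b * u) * V u\<close> is nonincreasing. The rate \<open>b\<close>
  may be 0, in which case the conclusion is monotonicity; the invariance arguments below use this
  case.\<close>

lemma exponential_decay:
  fixes V :: "real \<Rightarrow> real"
  assumes "0 \<le> t" and cont: "continuous_on {0..t} V"
    and deriv: "\<And>u. 0 < u \<Longrightarrow> u < t \<Longrightarrow> \<exists>D. (V has_real_derivative D) (at u) \<and> D \<le> - b * V u"
  shows "V t \<le> V 0 * exp (- b * t)"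
proof -
  have "exp (b * t) * V t \<le> exp (b * 0) * V 0"
  proof (rule DERIV_nonpos_imp_decreasing_open[OF \<open>0 \<le> t\<close>])
    show "continuous_on {0..t} (\<lambda>u. exp (b * u) * V u)"
      by (intro continuous_on_mult continuous_on_exp continuous_on_const continuous_on_id cont)
    fix u assume "0 < u" "u < t"
    from deriv[OF this] obtain D where D: "(V has_real_derivative D) (at u)" "D \<le> - b * V u"
      by (elim exE conjE)
    have "((\<lambda>u. b * u) has_real_derivative b) (at u)"
      using DERIV_cmult_Id by blast
    from DERIV_mult[OF DERIV_fun_exp[OF this] D(1)]
    have "((\<lambda>u. exp (b * u) * V u) has_real_derivative exp (b * u) * (b * V u + D)) (at u)"
      by (simp add: algebra_simps)
    moreover have "exp (b * u) * (b * V u + D) \<le> 0"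
      using D(2) by (simp add: mult_le_0_iff)
    ultimately show "\<exists>y. ((\<lambda>u. exp (b * u) * V u) has_real_derivative y) (at u) \<and> y \<le> 0"
      by (intro exI conjI)
  qed
  then have "V t \<le> V 0 / exp (b * t)"
    by (simp add: pos_le_divide_eq mult.commute)
  then show ?thesis by (simp add: exp_minus divide_inverse)
qed

lemma smooth_signal_time_differentiable:
  assumes "smooth_signal f" "0 \<le> t"
  shows "time_differentiable f t" and "time_differentiable (time_deriv f) t"
  using assms unfolding smooth_signal_def
  by (metis funpow_0, metis One_nat_def funpow_0 funpow_simps_right(2) comp_apply)

lemma matrix_mult_uminus_left: "(- A) ** B = - (A ** B :: real ^ 'n ^ 'm)"
  by (simp add: vec_eq_iff matrix_matrix_mult_def sum_negf)

lemma matrix_mult_diff_right: "A ** (B - C) = A ** B - (A ** C :: real ^ 'n ^ 'm)"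
  by (simp add: vec_eq_iff matrix_matrix_mult_def sum_subtractf right_diff_distrib)


section \<open>Error dynamics\<close>

text \<open>The attitude seen from the commanded frame. \<open>Psi\<close> and \<open>e_R\<close>
  are functions of this matrix alone, and it obeys rigid body kinematics with angular velocity
  \<open>e_Omega\<close>.\<close>

definition rot_error :: "quadrotor \<Rightarrow> trajectory \<Rightarrow> real \<Rightarrow> real ^ 3 ^ 3" where
  "rot_error Q s t = transpose (R_c Q s t) ** att s t"

text \<open>The force with which the attitude error perturbs the translational error dynamics.\<close>

definition tilt_force :: "quadrotor \<Rightarrow> trajectory \<Rightarrow> real \<Rightarrow> real ^ 3" where
  "tilt_force Q s t = norm (desired_force Q s t) *\<^sub>R
     ((b3c Q s t \<bullet> (att s t *v e3)) *\<^sub>R (att s t *v e3) - b3c Q s t)"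

lemma transpose_rot_error: "transpose (rot_error Q s t) = transpose (att s t) ** R_c Q s t"
  by (simp add: rot_error_def matrix_transpose_mul)

lemma e_R_rot_error:
  "e_R Q s t = (1 / 2) *\<^sub>R vee (rot_error Q s t - transpose (rot_error Q s t))"
  by (simp add: e_R_def transpose_rot_error) (simp add: rot_error_def)

lemma Psi_rot_error: "Psi (att s t) (R_c Q s t) = (3 - trace (rot_error Q s t)) / 2"
  by (simp add: Psi_def rot_error_def trace_sub trace_I)

lemma e_Omega_rot_error:
  "e_Omega Q s t = angvel s t - transpose (rot_error Q s t) *v Omega_c Q s t"
  by (simp only: e_Omega_def transpose_rot_error)

lemma norm_desired_force_le:
  assumes "k_x Q > 0" "k_v Q > 0"
  shows "norm (desired_force Q s t) \<le>
    k_x Q * norm (e_x Q s t) + k_v Q * norm (e_v Q s t) + norm (feedforward Q t)"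
proof -
  have "norm (desired_force Q s t) \<le>
      norm (- (k_x Q *\<^sub>R e_x Q s t) - k_v Q *\<^sub>R e_v Q s t) + norm (feedforward Q t)"
    unfolding desired_force_def by (rule norm_triangle_ineq)
  also have "norm (- (k_x Q *\<^sub>R e_x Q s t) - k_v Q *\<^sub>R e_v Q s t) \<le>
      norm (k_x Q *\<^sub>R e_x Q s t) + norm (k_v Q *\<^sub>R e_v Q s t)"
    by (metis norm_minus_cancel norm_triangle_ineq4)
  finally show ?thesis using assms by simp
qed

locale tracking_solution =
  fixes Q :: quadrotor and T :: ereal and s :: trajectory
  assumes mass_pos: "mass Q > 0"
    and inertia_pd: "symmetric_pos_def (inertia Q)"
    and command_smooth: "smooth_signal (x_d Q)"
    and solution: "closed_loop Q T s"
begin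

context
  fixes t :: real
  assumes t: "0 \<le> t" "ereal t < T"
begin

lemma solution_at:
  shows "desired_force Q s t \<noteq> 0" "norm (b1c s t) = 1" "b1c s t \<bullet> b3c Q s t = 0"
    "(R_c Q s has_vector_derivative time_deriv (R_c Q s) t) (at t within {0..})"
    "(Omega_c Q s has_vector_derivative time_deriv (Omega_c Q s) t) (at t within {0..})"
    "rotation_matrix (att s t)"
    "(pos s has_vector_derivative vel s t) (at t within {0..})"
    "(vel s has_vector_derivative time_deriv (vel s) t) (at t within {0..})"
    "(att s has_vector_derivative att s t ** hat (angvel s t)) (at t within {0..})"
    "(angvel s has_vector_derivative time_deriv (angvel s) t) (at t within {0..})"
    "mass Q *\<^sub>R time_deriv (vel s) t =
       (mass Q * gravity Q) *\<^sub>R e3 - thrust Q s t *\<^sub>R (att s t *v e3)"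
    "inertia Q *v time_deriv (angvel s) t + angvel s t \<times> (inertia Q *v angvel s t) = moment Q s t"
proof -
  note * = solution[unfolded closed_loop_def, rule_format, OF t]
  have rates: "time_deriv (pos s) t = vel s t" "time_deriv (att s) t = att s t ** hat (angvel s t)"
    using * by blast+
  show "desired_force Q s t \<noteq> 0" "norm (b1c s t) = 1" "b1c s t \<bullet> b3c Q s t = 0"
    "(R_c Q s has_vector_derivative time_deriv (R_c Q s) t) (at t within {0..})"
    "(Omega_c Q s has_vector_derivative time_deriv (Omega_c Q s) t) (at t within {0..})"
    "rotation_matrix (att s t)"
    "(pos s has_vector_derivative vel s t) (at t within {0..})"
    "(vel s has_vector_derivative time_deriv (vel s) t) (at t within {0..})"
    "(att s has_vector_derivative att s t ** hat (angvel s t)) (at t within {0..})"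
    "(angvel s has_vector_derivative time_deriv (angvel s) t) (at t within {0..})"
    "mass Q *\<^sub>R time_deriv (vel s) t =
       (mass Q * gravity Q) *\<^sub>R e3 - thrust Q s t *\<^sub>R (att s t *v e3)"
    "inertia Q *v time_deriv (angvel s) t + angvel s t \<times> (inertia Q *v angvel s t) = moment Q s t"
    using * unfolding time_deriv_works SO3_iff_rotation_matrix rates by blast+
qed

lemma norm_b3c: "norm (b3c Q s t) = 1"
  using solution_at(1) by (simp add: b3c_def)

lemma rotation_R_c: "rotation_matrix (R_c Q s t)"
  unfolding R_c_def by (rule orthonormal_frame_rotation[OF solution_at(2) norm_b3c solution_at(3)])

lemma rotation_rot_error: "rotation_matrix (rot_error Q s t)"
  unfolding rot_error_def
  by (intro rotation_matrix_mul rotation_matrix_transpose rotation_R_c solution_at(6))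

lemma Psi_bounds: "0 \<le> Psi (att s t) (R_c Q s t)" "Psi (att s t) (R_c Q s t) \<le> 2"
  using rotation_matrix_trace_bounds[OF rotation_rot_error] by (simp_all add: Psi_rot_error)

text \<open>In terms of the angle \<theta> of \<open>rot_error\<close>, \<open>Psi\<close> is 1 -
  cos \<theta> and the norm of \<open>e_R\<close> is the absolute value of sin \<theta>.\<close>

lemma norm_e_R_sq:
  "(norm (e_R Q s t))\<^sup>2 = Psi (att s t) (R_c Q s t) * (2 - Psi (att s t) (R_c Q s t))"
proof -
  have "(norm (e_R Q s t))\<^sup>2 =
      (norm (vee (rot_error Q s t - transpose (rot_error Q s t))))\<^sup>2 / 4"
    by (simp add: e_R_rot_error power_divide)
  then show ?thesis
    unfolding norm_vee_rotation[OF rotation_rot_error] Psi_rot_error by (simp add: field_simps)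
qed

text \<open>Up to sign and the factor \<open>norm (desired_force Q s t)\<close>, the tilt force is
  the component of \<open>b3c\<close> orthogonal to the thrust axis, whose squared length is
  \<open>1 - q^2\<close> with \<open>q\<close> the cosine of the tilt. By the tilt estimate
  \<open>q\<close> is at least \<open>1 - Psi\<close>; this is nonnegative when \<open>Psi\<close>
  is at most 1, so squaring preserves the inequality and yields \<open>Psi * (2 - Psi)\<close>, the
  squared norm of \<open>e_R\<close>.\<close>

lemma norm_tilt_force_le:
  assumes "Psi (att s t) (R_c Q s t) \<le> 1"
  shows "norm (tilt_force Q s t) \<le> norm (desired_force Q s t) * norm (e_R Q s t)"
proof -
  let ?r = "att s t *v e3" and ?b = "b3c Q s t" and ?\<Psi> = "Psi (att s t) (R_c Q s t)"
  let ?q = "rot_error Q s t $ 3 $ 3"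
  have "R_c Q s t *v e3 = ?b"
    by (simp add: R_c_def e3_def transpose_def matrix_vector_mult_def sum_3 vec_eq_iff forall_3)
  then have "?b \<bullet> ?r = (R_c Q s t *v e3) \<bullet> ?r" by simp
  also have "\<dots> = e3 \<bullet> (transpose (R_c Q s t) *v ?r)"
    using dot_lmul_matrix[of e3 "transpose (R_c Q s t)" ?r] unfolding vector_transpose_matrix .
  also have "transpose (R_c Q s t) *v ?r = rot_error Q s t *v e3"
    unfolding rot_error_def matrix_vector_mul_assoc ..
  also have "e3 \<bullet> (rot_error Q s t *v e3) = ?q"
    by (simp add: e3_def inner_vec_def matrix_vector_mult_def sum_3)
  finally have br: "?b \<bullet> ?r = ?q" .
  have r: "norm ?r = 1"
    using rotation_matrix_norm[OF solution_at(6)] by (simp add: e3_def norm_vec_def L2_set_def sum_3)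
  have "(norm ((?b \<bullet> ?r) *\<^sub>R ?r - ?b))\<^sup>2 = 1 - ?q\<^sup>2"
  proof -
    have "?r \<bullet> ?r = 1" "?b \<bullet> ?b = 1" using r norm_b3c by (simp_all add: norm_eq_1)
    then show ?thesis
      using br unfolding power2_norm_eq_inner
      by (simp add: inner_diff_left inner_diff_right inner_commute[of ?r ?b] power2_eq_square)
  qed
  also have "\<dots> \<le> 1 - (1 - ?\<Psi>)\<^sup>2"
    using rotation_matrix_tilt_lower[OF rotation_rot_error] assms
    by (intro diff_left_mono power_mono) (auto simp: Psi_rot_error field_simps)
  also have "\<dots> = (norm (e_R Q s t))\<^sup>2"
    unfolding norm_e_R_sq by (simp add: power2_eq_square algebra_simps)
  finally have "norm ((?b \<bullet> ?r) *\<^sub>R ?r - ?b) \<le> norm (e_R Q s t)"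
    by (rule power2_le_imp_le) simp
  then show ?thesis by (simp add: tilt_force_def mult_left_mono)
qed

section \<open>Derivatives of the error variables along a solution\<close>

lemma e_x_deriv: "(e_x Q s has_vector_derivative e_v Q s t) (at t within {0..})"
proof -
  have "((\<lambda>u. pos s u - x_d Q u) has_vector_derivative vel s t - time_deriv (x_d Q) t)
      (at t within {0..})"
    using solution_at(7) smooth_signal_time_differentiable(1)[OF command_smooth t(1)]
    by (intro has_vector_derivative_diff) (simp_all add: time_deriv_works)
  then show ?thesis by (simp add: e_x_def[abs_def] e_v_def)
qed

text \<open>The thrust realises only the projection of the desired force onto the thrust axis. With
  the full force the error would obey a damped spring equation; the missing orthogonal component is
  the tilt force.\<close>

lemma e_v_deriv:
  obtains a where "(e_v Q s has_vector_derivative a) (at t within {0..})"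
    and "mass Q *\<^sub>R a = - (k_x Q *\<^sub>R e_x Q s t) - k_v Q *\<^sub>R e_v Q s t - tilt_force Q s t"
proof
  let ?a = "time_deriv (vel s) t - time_deriv (time_deriv (x_d Q)) t"
  let ?F = "desired_force Q s t" and ?r = "att s t *v e3"
  have "((\<lambda>u. vel s u - time_deriv (x_d Q) u) has_vector_derivative ?a) (at t within {0..})"
    using solution_at(8) smooth_signal_time_differentiable(2)[OF command_smooth t(1)]
    by (intro has_vector_derivative_diff) (simp_all add: time_deriv_works)
  then show "(e_v Q s has_vector_derivative ?a) (at t within {0..})"
    by (simp add: e_v_def[abs_def])
  have thrust: "thrust Q s t = - (?F \<bullet> ?r)"
    unfolding thrust_def desired_force_def feedforward_def
    by (simp add: inner_add_left inner_diff_left)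
  have F: "?F = - (norm ?F *\<^sub>R b3c Q s t)"
    using solution_at(1) by (simp add: b3c_def)
  have "?F \<bullet> ?r = - (norm ?F * (b3c Q s t \<bullet> ?r))"
    using arg_cong[OF F, of "\<lambda>v. v \<bullet> ?r"] by simp
  then have "tilt_force Q s t = ?F - (?F \<bullet> ?r) *\<^sub>R ?r"
    using F by (simp add: tilt_force_def scaleR_diff_right)
  moreover have "mass Q *\<^sub>R ?a = (mass Q * gravity Q) *\<^sub>R e3 - thrust Q s t *\<^sub>R ?r
      - mass Q *\<^sub>R time_deriv (time_deriv (x_d Q)) t"
    by (simp add: scaleR_diff_right solution_at(11))
  ultimately show "mass Q *\<^sub>R ?a =
      - (k_x Q *\<^sub>R e_x Q s t) - k_v Q *\<^sub>R e_v Q s t - tilt_force Q s t"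
    by (simp add: thrust) (simp add: desired_force_def feedforward_def)
qed

lemma R_c_deriv:
  "(R_c Q s has_vector_derivative R_c Q s t ** hat (Omega_c Q s t)) (at t within {0..})"
proof -
  let ?R = "R_c Q s t" and ?R' = "time_deriv (R_c Q s) t"
  \<comment> \<open>A time strictly between \<open>t\<close> and \<open>T\<close>, which may be
    infinite, provides the radius \<open>r - t\<close> within which \<open>R_c\<close> is known to
    be orthogonal.\<close>
  obtain r where r: "ereal t < ereal r" "ereal r < T" using t(2) ereal_dense2 by blast
  have "orthogonal_matrix (R_c Q s u)" if "0 \<le> u" "dist u t < r - t" for u
  proof -
    have "ereal u < T" using r(2) that(2) by (auto simp: dist_real_def intro: less_trans[of _ "ereal r"])
    then show ?thesis
      using tracking_solution.rotation_R_c[OF tracking_solution_axioms that(1)]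
      by (simp add: rotation_matrix_def)
  qed
  then have "transpose (transpose ?R ** ?R') = - (transpose ?R ** ?R')"
    using r(1) by (intro deriv_within_orthogonal_skew[OF solution_at(4) t(1), of "r - t"]) auto
  then have "hat (Omega_c Q s t) = transpose ?R ** ?R'"
    unfolding Omega_c_def by (rule vee_skew(1))
  then have "?R ** hat (Omega_c Q s t) = (?R ** transpose ?R) ** ?R'"
    by (simp add: matrix_mul_assoc)
  also have "\<dots> = ?R'"
    using rotation_R_c by (simp add: rotation_matrix_def orthogonal_matrix_def)
  finally show ?thesis using solution_at(4) by simp
qed

text \<open>The product rule yields one term with the body rate on the right and one with
  \<open>hat\<close> of the commanded rate on the left. Conjugation by the rotation moves the latter
  to the right, where the two rates combine to \<open>e_Omega\<close>.\<close>

lemma rot_error_deriv: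
  "(rot_error Q s has_vector_derivative rot_error Q s t ** hat (e_Omega Q s t)) (at t within {0..})"
proof -
  let ?P = "rot_error Q s t" and ?w = "Omega_c Q s t"
  have eq: "rot_error Q s = (\<lambda>u. transpose (R_c Q s u) ** att s u)"
    by (simp add: rot_error_def fun_eq_iff)
  have "((\<lambda>u. transpose (R_c Q s u) ** att s u) has_vector_derivative
      transpose (R_c Q s t) ** (att s t ** hat (angvel s t))
      + transpose (R_c Q s t ** hat ?w) ** att s t) (at t within {0..})"
    by (intro bounded_bilinear.has_vector_derivative[OF bounded_bilinear_matrix_mult]
        bounded_linear.has_vector_derivative[OF bounded_linear_transpose] R_c_deriv solution_at(9))
  moreover have "transpose (R_c Q s t ** hat ?w) ** att s t = - (?P ** hat (transpose ?P *v ?w))"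
    unfolding matrix_transpose_mul transpose_hat rotation_matrix_hat_conj[OF rotation_rot_error, symmetric]
    by (simp add: rot_error_def matrix_mul_assoc matrix_mult_uminus_left)
  moreover have "transpose (R_c Q s t) ** (att s t ** hat (angvel s t)) = ?P ** hat (angvel s t)"
    by (simp add: rot_error_def matrix_mul_assoc)
  ultimately show ?thesis
    unfolding e_Omega_rot_error hat_diff matrix_mult_diff_right eq by simp
qed

lemma Psi_deriv:
  "((\<lambda>u. Psi (att s u) (R_c Q s u)) has_vector_derivative e_R Q s t \<bullet> e_Omega Q s t)
     (at t within {0..})"
proof -
  have "((\<lambda>u. (3 - trace (rot_error Q s u)) * (1 / 2)) has_vector_derivative
      (0 - trace (rot_error Q s t ** hat (e_Omega Q s t))) * (1 / 2)) (at t within {0..})"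
    by (intro bounded_linear.has_vector_derivative[OF bounded_linear_mult_left]
        has_vector_derivative_diff has_vector_derivative_const
        bounded_linear.has_vector_derivative[OF bounded_linear_trace] rot_error_deriv)
  then show ?thesis
    by (simp add: Psi_rot_error trace_mult_hat e_R_rot_error inner_commute)
qed

text \<open>Only the product of the rate with \<open>e_Omega\<close> enters the Lyapunov estimate,
  through the cross term. The factor 1/2 in \<open>e_R\<close> cancels the 2 of
  \<open>rotation_matrix_trace_quadratic\<close>.\<close>

lemma e_R_deriv:
  obtains r where "(e_R Q s has_vector_derivative r) (at t within {0..})"
    and "r \<bullet> e_Omega Q s t \<le> (norm (e_Omega Q s t))\<^sup>2"
proof
  let ?w = "e_Omega Q s t"
  let ?P' = "rot_error Q s t ** hat ?w"
  show "(e_R Q s has_vector_derivative (1 / 2) *\<^sub>R vee (?P' - transpose ?P')) (at t within {0..})"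
    unfolding e_R_rot_error[abs_def]
    by (intro bounded_linear.has_vector_derivative[OF bounded_linear_scaleR_right]
        bounded_linear.has_vector_derivative[OF bounded_linear_vee_diff_transpose] rot_error_deriv)
  show "((1 / 2) *\<^sub>R vee (?P' - transpose ?P')) \<bullet> ?w \<le> (norm ?w)\<^sup>2"
    using rotation_matrix_trace_quadratic[OF rotation_rot_error, of ?w]
    by (simp add: inner_commute)
qed

text \<open>The gyroscopic and feedforward terms of the moment are chosen to cancel everything
  except the proportional and the damping term.\<close>

lemma e_Omega_deriv:
  obtains u where "(e_Omega Q s has_vector_derivative u) (at t within {0..})"
    and "inertia Q *v u = - (k_R Q *\<^sub>R e_R Q s t) - k_Omega Q *\<^sub>R e_Omega Q s t"
proof
  let ?w = "e_Omega Q s t" and ?P = "rot_error Q s t" and ?wc = "Omega_c Q s t"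
  let ?J = "inertia Q" and ?wc' = "time_deriv (Omega_c Q s) t"
  let ?u = "time_deriv (angvel s) t - (transpose ?P *v ?wc' + transpose (?P ** hat ?w) *v ?wc)"
  have "((\<lambda>u. angvel s u - transpose (rot_error Q s u) *v Omega_c Q s u) has_vector_derivative ?u)
      (at t within {0..})"
    by (intro has_vector_derivative_diff solution_at(10) solution_at(5) rot_error_deriv
        bounded_bilinear.has_vector_derivative[OF bounded_bilinear_matrix_vector_mult]
        bounded_linear.has_vector_derivative[OF bounded_linear_transpose])
  then show "(e_Omega Q s has_vector_derivative ?u) (at t within {0..})"
    by (simp only: e_Omega_rot_error[abs_def])
  define v where "v = transpose ?P *v ?wc"
  have "transpose (?P ** hat ?w) *v ?wc = - (?w \<times> v)"
    unfolding matrix_transpose_mul transpose_hat matrix_mult_uminus_left matrix_vector_mult_uminus_left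
      v_def matrix_vector_mul_assoc[symmetric] hat_mult_vec ..
  \<comment> \<open>Here \<open>e_Omega\<close> is \<open>angvel - v\<close>, and \<open>v\<close>
    has zero cross product with itself.\<close>
  also have "?w \<times> v = angvel s t \<times> v"
    unfolding e_Omega_rot_error v_def[symmetric] Cross3.left_diff_distrib by simp
  finally have u: "?u = time_deriv (angvel s) t - transpose ?P *v ?wc' + angvel s t \<times> v" by simp
  have "moment Q s t = - (k_R Q *\<^sub>R e_R Q s t) - k_Omega Q *\<^sub>R ?w
      + angvel s t \<times> (?J *v angvel s t) - ?J *v (angvel s t \<times> v - transpose ?P *v ?wc')"
    unfolding moment_def transpose_rot_error v_def
    by (simp only: matrix_mul_assoc[symmetric] matrix_vector_mul_assoc[symmetric] hat_mult_vec)
  then show "?J *v ?u = - (k_R Q *\<^sub>R e_R Q s t) - k_Omega Q *\<^sub>R ?w"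
    unfolding u using solution_at(12)
    by (simp only: matrix_vector_mult_diff_distrib matrix_vector_right_distrib) (simp add: algebra_simps)
qed

end

end


section \<open>Lyapunov functions\<close>

definition translation_lyapunov :: "quadrotor \<Rightarrow> real \<Rightarrow> trajectory \<Rightarrow> real \<Rightarrow> real" where
  "translation_lyapunov Q c s t = k_x Q / 2 * (e_x Q s t \<bullet> e_x Q s t)
     + mass Q / 2 * (e_v Q s t \<bullet> e_v Q s t) + c * (e_x Q s t \<bullet> e_v Q s t)"

text \<open>The weight \<open>c\<close> of the cross term is a parameter because
  \<open>c = 0\<close> serves the invariance of the bound on \<open>Psi\<close>, and
  \<open>c = c2\<close> the exponential decay.\<close>

definition attitude_lyapunov :: "quadrotor \<Rightarrow> real \<Rightarrow> trajectory \<Rightarrow> real \<Rightarrow> real" where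
  "attitude_lyapunov Q c s t = 1 / 2 * (e_Omega Q s t \<bullet> (inertia Q *v e_Omega Q s t))
     + k_R Q * Psi (att s t) (R_c Q s t) + c * (e_R Q s t \<bullet> e_Omega Q s t)"

lemma inner_bounds: "- (norm x * norm y) \<le> x \<bullet> y" "x \<bullet> y \<le> norm x * norm y"
  using Cauchy_Schwarz_ineq2[of x y] by simp_all

lemma translation_lyapunov_bounds:
  assumes "0 \<le> c"
  shows "k_x Q / 2 * (norm (e_x Q s t))\<^sup>2 - c * (norm (e_x Q s t) * norm (e_v Q s t))
      + mass Q / 2 * (norm (e_v Q s t))\<^sup>2 \<le> translation_lyapunov Q c s t"
    and "translation_lyapunov Q c s t \<le> k_x Q / 2 * (norm (e_x Q s t))\<^sup>2
      + c * (norm (e_x Q s t) * norm (e_v Q s t)) + mass Q / 2 * (norm (e_v Q s t))\<^sup>2"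
  using mult_left_mono[OF inner_bounds(1)[of "e_x Q s t" "e_v Q s t"] assms]
    mult_left_mono[OF inner_bounds(2)[of "e_x Q s t" "e_v Q s t"] assms]
  by (simp_all add: translation_lyapunov_def power2_norm_eq_inner)

text \<open>In the expanded product, \<open>r \<le> \<alpha>\<close> suffices for all quadratic
  terms except \<open>kx * a * b\<close>. That one is made linear in \<open>b\<close> by
  \<open>a \<le> E\<close>, which is where the a priori bound on the position error enters.\<close>

lemma tilt_product_bound:
  fixes a b r :: real
  assumes "0 \<le> r" "r \<le> \<alpha>" "0 \<le> a" "a \<le> E" "0 \<le> b" "0 \<le> \<gamma>" "0 \<le> kx" "0 \<le> kv"
  shows "(\<gamma> * a + b) * ((kx * a + kv * b + B) * r)
    \<le> \<alpha> * (\<gamma> * kx * a\<^sup>2 + kv * b\<^sup>2 + \<gamma> * kv * (a * b)) + r * (\<gamma> * B * a + (B + kx * E) * b)"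
proof -
  have "0 \<le> (\<alpha> - r) * (\<gamma> * kx * a\<^sup>2 + kv * b\<^sup>2 + \<gamma> * kv * (a * b)) + r * kx * b * (E - a)"
    using assms by (intro add_nonneg_nonneg mult_nonneg_nonneg) auto
  then show ?thesis by (simp add: power2_eq_square algebra_simps)
qed

lemma mult_two_minus_mono:
  fixes x y :: real
  assumes "0 \<le> x" "x \<le> y" "y \<le> 1"
  shows "x * (2 - x) \<le> y * (2 - y)"
proof -
  have "0 \<le> (y - x) * (2 - x - y)" using assms by (intro mult_nonneg_nonneg) auto
  then show ?thesis by (simp add: algebra_simps)
qed

lemma has_real_derivative_at_within_atLeast:
  fixes f :: "real \<Rightarrow> real"
  assumes "0 < u"
  shows "(f has_vector_derivative D) (at u within {0..}) \<longleftrightarrow> (f has_real_derivative D) (at u)"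
proof -
  have "at u within {0..} = at u" using assms by (intro at_within_interior) simp
  then show ?thesis by (simp add: has_real_derivative_iff_has_vector_derivative)
qed

lemma continuous_on_if_within_derivatives:
  fixes f :: "real \<Rightarrow> 'a::real_normed_vector"
  assumes "\<And>u. 0 \<le> u \<Longrightarrow> u \<le> t \<Longrightarrow> \<exists>D. (f has_vector_derivative D) (at u within {0..})"
  shows "continuous_on {0..t} f"
  unfolding continuous_on_eq_continuous_within
proof
  fix u assume "u \<in> {0..t}"
  then obtain D where "(f has_vector_derivative D) (at u within {0..})" using assms by auto
  then have "continuous (at u within {0..}) f" by (rule has_vector_derivative_continuous)
  then show "continuous (at u within {0..t}) f" by (rule continuous_within_subset) auto
qed

context tracking_solution
begin

text \<open>Without tilt force the derivative is the form of \<open>W1\<close> with \<alpha>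
  replaced by 0. The tilt force adds terms proportional to \<alpha>, which complete
  \<open>W1\<close>, and terms proportional to the norm of \<open>e_R\<close>, which have the shape
  of \<open>W12\<close>.\<close>

lemma translation_lyapunov_decay:
  assumes t: "0 \<le> t" "ereal t < T"
    and gains: "k_x Q > 0" "k_v Q > 0" "c > 0"
    and Psi: "Psi (att s t) (R_c Q s t) \<le> \<psi>1" "\<psi>1 < 1"
    and ff: "norm (feedforward Q t) \<le> B" and E: "norm (e_x Q s t) \<le> E"
  obtains D where "(translation_lyapunov Q c s has_vector_derivative D) (at t within {0..})"
    and "D \<le> - (z1 Q s t \<bullet> (W1 Q c \<psi>1 *v z1 Q s t))
      + norm (e_R Q s t) * (c / mass Q * B * norm (e_x Q s t) + (B + k_x Q * E) * norm (e_v Q s t))"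
proof -
  let ?x = "e_x Q s t" and ?v = "e_v Q s t" and ?X = "tilt_force Q s t" and ?m = "mass Q"
  let ?a = "norm ?x" and ?b = "norm ?v" and ?r = "norm (e_R Q s t)" and ?\<alpha> = "alpha \<psi>1"
  define \<gamma> where "\<gamma> = c / ?m"
  have \<gamma>: "\<gamma> > 0" "\<gamma> * ?m = c" using gains mass_pos by (simp_all add: \<gamma>_def)
  obtain a where a: "(e_v Q s has_vector_derivative a) (at t within {0..})"
    "?m *\<^sub>R a = - (k_x Q *\<^sub>R ?x) - k_v Q *\<^sub>R ?v - ?X"
    by (rule e_v_deriv[OF t])
  define D where "D = k_x Q / 2 * (?x \<bullet> ?v + ?v \<bullet> ?x) + ?m / 2 * (?v \<bullet> a + a \<bullet> ?v)
      + c * (?x \<bullet> a + ?v \<bullet> ?v)"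
  have deriv: "(translation_lyapunov Q c s has_vector_derivative D) (at t within {0..})"
    unfolding translation_lyapunov_def[abs_def] D_def
    by (intro has_vector_derivative_add bounded_linear.has_vector_derivative[OF bounded_linear_mult_right]
        bounded_bilinear.has_vector_derivative[OF bounded_bilinear_inner] a(1) e_x_deriv[OF t])
  have inner_a: "?m * (y \<bullet> a) = - (k_x Q * (y \<bullet> ?x)) - k_v Q * (y \<bullet> ?v) - y \<bullet> ?X" for y
    using arg_cong[OF a(2), of "\<lambda>z. y \<bullet> z"] by (simp add: inner_diff_right)
  have "D = k_x Q * (?x \<bullet> ?v) + ?m * (?v \<bullet> a) + \<gamma> * (?m * (?x \<bullet> a)) + c * (?v \<bullet> ?v)"
    unfolding D_def \<gamma>(2)[symmetric]
    by (simp add: inner_commute[of a] inner_commute[of ?v ?x] algebra_simps)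
  \<comment> \<open>The spring force in \<open>?m * (?v \<bullet> a)\<close> cancels the derivative
    of the potential energy.\<close>
  also have "\<dots> = - (k_v Q - c) * ?b\<^sup>2 - \<gamma> * k_x Q * ?a\<^sup>2 - \<gamma> * k_v Q * (?x \<bullet> ?v)
      - \<gamma> * (?x \<bullet> ?X) - ?v \<bullet> ?X"
    unfolding inner_a by (simp add: inner_commute[of ?v ?x] power2_norm_eq_inner algebra_simps)
  also have "\<dots> \<le> - (k_v Q - c) * ?b\<^sup>2 - \<gamma> * k_x Q * ?a\<^sup>2 + \<gamma> * k_v Q * (?a * ?b)
      + (\<gamma> * ?a + ?b) * norm ?X"
  proof -
    have "\<gamma> * k_v Q * (- (?a * ?b)) \<le> \<gamma> * k_v Q * (?x \<bullet> ?v)"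
      "\<gamma> * (- (?a * norm ?X)) \<le> \<gamma> * (?x \<bullet> ?X)" "- (?b * norm ?X) \<le> ?v \<bullet> ?X"
      using \<gamma>(1) gains by (intro mult_left_mono inner_bounds; simp)+
    then show ?thesis by (simp add: algebra_simps)
  qed
  also have "(\<gamma> * ?a + ?b) * norm ?X \<le> (\<gamma> * ?a + ?b) * ((k_x Q * ?a + k_v Q * ?b + B) * ?r)"
  proof (rule mult_left_mono)
    have "norm ?X \<le> norm (desired_force Q s t) * ?r"
      using Psi by (intro norm_tilt_force_le[OF t]) simp
    also have "\<dots> \<le> (k_x Q * ?a + k_v Q * ?b + B) * ?r"
      using norm_desired_force_le[OF gains(1,2), of s t] ff by (intro mult_right_mono) auto
    finally show "norm ?X \<le> (k_x Q * ?a + k_v Q * ?b + B) * ?r" .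
  qed (use \<gamma>(1) in simp)
  also have "\<dots> \<le> ?\<alpha> * (\<gamma> * k_x Q * ?a\<^sup>2 + k_v Q * ?b\<^sup>2 + \<gamma> * k_v Q * (?a * ?b))
      + ?r * (\<gamma> * B * ?a + (B + k_x Q * E) * ?b)"
  proof (rule tilt_product_bound)
    have "?r\<^sup>2 \<le> \<psi>1 * (2 - \<psi>1)"
      unfolding norm_e_R_sq[OF t] using Psi by (intro mult_two_minus_mono Psi_bounds[OF t]) auto
    then show "?r \<le> ?\<alpha>" unfolding alpha_def by (rule real_le_rsqrt)
  qed (use \<gamma>(1) gains E in auto)
  finally have "D \<le> - (k_v Q - c) * ?b\<^sup>2 - \<gamma> * k_x Q * ?a\<^sup>2 + \<gamma> * k_v Q * (?a * ?b)
      + (?\<alpha> * (\<gamma> * k_x Q * ?a\<^sup>2 + k_v Q * ?b\<^sup>2 + \<gamma> * k_v Q * (?a * ?b))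
      + ?r * (\<gamma> * B * ?a + (B + k_x Q * E) * ?b))"
    by simp
  also have "\<dots> = - (z1 Q s t \<bullet> (W1 Q c \<psi>1 *v z1 Q s t))
      + ?r * (c / ?m * B * ?a + (B + k_x Q * E) * ?b)"
    unfolding z1_def W1_def sym2_quadratic_form \<gamma>_def
    using mass_pos by (simp add: field_simps)
  finally show ?thesis using deriv that by blast
qed

text \<open>The terms \<open>k_R * (e_R \<bullet> e_Omega)\<close> from the kinetic energy and from
  \<open>Psi\<close> cancel, leaving the damping. The cross term supplies the decay in
  \<open>e_R\<close> at the price of the off-diagonal entries of \<open>W2\<close>.\<close>

lemma attitude_lyapunov_decay:
  assumes t: "0 \<le> t" "ereal t < T"
    and gains: "k_R Q > 0" "k_Omega Q > 0" "c \<ge> 0"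
  obtains D where "(attitude_lyapunov Q c s has_vector_derivative D) (at t within {0..})"
    and "D \<le> - (z2 Q s t \<bullet> (W2 Q c *v z2 Q s t))"
proof -
  let ?w = "e_Omega Q s t" and ?e = "e_R Q s t" and ?J = "inertia Q"
  obtain e' where e': "(e_R Q s has_vector_derivative e') (at t within {0..})" "e' \<bullet> ?w \<le> (norm ?w)\<^sup>2"
    by (rule e_R_deriv[OF t])
  obtain u where u: "(e_Omega Q s has_vector_derivative u) (at t within {0..})"
    "?J *v u = - (k_R Q *\<^sub>R ?e) - k_Omega Q *\<^sub>R ?w"
    by (rule e_Omega_deriv[OF t])
  have sym: "x \<bullet> (?J *v y) = (?J *v x) \<bullet> y" for x y
    using inertia_pd symmetric_inner_commute by (metis symmetric_pos_def_def)
  define D where "D = 1 / 2 * (?w \<bullet> (?J *v u) + u \<bullet> (?J *v ?w)) + k_R Q * (?e \<bullet> ?w)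
      + c * (?e \<bullet> u + e' \<bullet> ?w)"
  have deriv: "(attitude_lyapunov Q c s has_vector_derivative D) (at t within {0..})"
    unfolding attitude_lyapunov_def[abs_def] D_def
    by (intro has_vector_derivative_add bounded_linear.has_vector_derivative[OF bounded_linear_mult_right]
        bounded_bilinear.has_vector_derivative[OF bounded_bilinear_inner] e' u Psi_deriv[OF t]
        bounded_linear.has_vector_derivative[OF matrix_vector_mul_bounded_linear])
  \<comment> \<open>With the inverse inertia moved onto \<open>e_R\<close>, the product
    \<open>?e \<bullet> u\<close> becomes \<open>p \<bullet> (?J *v u)\<close>, to which the error
    dynamics apply.\<close>
  obtain p where p: "?J *v p = ?e" by (rule pos_def_solvable[OF inertia_pd])
  have "?e \<bullet> u = p \<bullet> (?J *v u)" by (simp add: sym p)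
  also have "\<dots> = - (k_R Q * (?e \<bullet> p)) - k_Omega Q * (p \<bullet> ?w)"
    unfolding u(2) by (simp add: inner_diff_right inner_commute)
  also have "\<dots> \<le> - (k_R Q * ((norm ?e)\<^sup>2 / lambda_max ?J))
      + k_Omega Q * (norm ?e / lambda_min ?J * norm ?w)"
  proof -
    have "k_R Q * ((norm ?e)\<^sup>2 / lambda_max ?J) \<le> k_R Q * (?e \<bullet> p)"
      using pos_def_solution_inner_lower[OF inertia_pd p] gains by (intro mult_left_mono) auto
    moreover have "- (norm ?e / lambda_min ?J * norm ?w) \<le> p \<bullet> ?w"
      using inner_bounds(1)[of p ?w]
        mult_right_mono[OF pos_def_solution_norm_upper[OF inertia_pd p], of "norm ?w"] by simp
    then have "k_Omega Q * (- (norm ?e / lambda_min ?J * norm ?w)) \<le> k_Omega Q * (p \<bullet> ?w)"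
      using gains by (intro mult_left_mono) auto
    ultimately show ?thesis by simp
  qed
  finally have acc: "c * (?e \<bullet> u + e' \<bullet> ?w) \<le> c * (- (k_R Q * ((norm ?e)\<^sup>2 / lambda_max ?J))
      + k_Omega Q * (norm ?e / lambda_min ?J * norm ?w) + (norm ?w)\<^sup>2)"
    using e'(2) gains by (intro mult_left_mono) auto
  have "?w \<bullet> (?J *v u) = - (k_R Q * (?e \<bullet> ?w)) - k_Omega Q * (norm ?w)\<^sup>2"
    unfolding u(2) by (simp add: inner_diff_right inner_commute power2_norm_eq_inner)
  moreover have "u \<bullet> (?J *v ?w) = ?w \<bullet> (?J *v u)"
    using sym[of u ?w] by (simp add: inner_commute)
  ultimately have "D = - k_Omega Q * (norm ?w)\<^sup>2 + c * (?e \<bullet> u + e' \<bullet> ?w)"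
    by (simp add: D_def field_simps)
  with acc have "D \<le> - k_Omega Q * (norm ?w)\<^sup>2 + c * (- (k_R Q * ((norm ?e)\<^sup>2 / lambda_max ?J))
      + k_Omega Q * (norm ?e / lambda_min ?J * norm ?w) + (norm ?w)\<^sup>2)"
    by linarith
  also have "\<dots> = - (z2 Q s t \<bullet> (W2 Q c *v z2 Q s t))"
    unfolding z2_def W2_def sym2_quadratic_form by (simp add: algebra_simps)
  finally show ?thesis using deriv that by blast
qed

text \<open>Both bounds rest on \<open>Psi * (2 - Psi)\<close> being the squared norm of
  \<open>e_R\<close>: the factor \<open>2 - Psi\<close> is at most 2, and on the sublevel set it is
  at least \<open>2 - \<psi>1\<close>, which explains the first entry of
  \<open>M22'\<close>.\<close>

lemma attitude_lyapunov_bounds: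
  assumes t: "0 \<le> t" "ereal t < T" and "k_R Q > 0" "c \<ge> 0"
  shows "k_R Q / 2 * (norm (e_R Q s t))\<^sup>2 - c * (norm (e_R Q s t) * norm (e_Omega Q s t))
      + lambda_min (inertia Q) / 2 * (norm (e_Omega Q s t))\<^sup>2 \<le> attitude_lyapunov Q c s t"
    and "Psi (att s t) (R_c Q s t) \<le> \<psi>1 \<Longrightarrow> \<psi>1 < 1 \<Longrightarrow>
      attitude_lyapunov Q c s t \<le> k_R Q / (2 - \<psi>1) * (norm (e_R Q s t))\<^sup>2
        + c * (norm (e_R Q s t) * norm (e_Omega Q s t))
        + lambda_max (inertia Q) / 2 * (norm (e_Omega Q s t))\<^sup>2"
proof -
  let ?w = "e_Omega Q s t" and ?e = "e_R Q s t" and ?\<Psi> = "Psi (att s t) (R_c Q s t)"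
  have J: "lambda_min (inertia Q) * (norm ?w)\<^sup>2 \<le> ?w \<bullet> (inertia Q *v ?w)"
    "?w \<bullet> (inertia Q *v ?w) \<le> lambda_max (inertia Q) * (norm ?w)\<^sup>2"
    using inertia_pd lambda_min_quadratic_form lambda_max_quadratic_form
    by (auto simp: symmetric_pos_def_def)
  have cross: "c * (- (norm ?e * norm ?w)) \<le> c * (?e \<bullet> ?w)" "c * (?e \<bullet> ?w) \<le> c * (norm ?e * norm ?w)"
    using assms(4) by (intro mult_left_mono inner_bounds; simp)+
  have "(norm ?e)\<^sup>2 / 2 \<le> ?\<Psi>"
    unfolding norm_e_R_sq[OF t] using zero_le_square[of ?\<Psi>] by (simp add: algebra_simps)
  then have "k_R Q * ((norm ?e)\<^sup>2 / 2) \<le> k_R Q * ?\<Psi>" using assms(3) by (intro mult_left_mono) auto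
  then show "k_R Q / 2 * (norm ?e)\<^sup>2 - c * (norm ?e * norm ?w)
      + lambda_min (inertia Q) / 2 * (norm ?w)\<^sup>2 \<le> attitude_lyapunov Q c s t"
    using J(1) cross(1) by (simp add: attitude_lyapunov_def)
  assume \<psi>: "?\<Psi> \<le> \<psi>1" "\<psi>1 < 1"
  have "?\<Psi> * (2 - \<psi>1) \<le> ?\<Psi> * (2 - ?\<Psi>)"
    using \<psi> Psi_bounds[OF t] by (intro mult_left_mono) auto
  then have "?\<Psi> \<le> (norm ?e)\<^sup>2 / (2 - \<psi>1)"
    unfolding norm_e_R_sq[OF t] using \<psi> by (simp add: pos_le_divide_eq)
  then have "k_R Q * ?\<Psi> \<le> k_R Q * ((norm ?e)\<^sup>2 / (2 - \<psi>1))"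
    using assms(3) by (intro mult_left_mono) auto
  then show "attitude_lyapunov Q c s t \<le> k_R Q / (2 - \<psi>1) * (norm ?e)\<^sup>2
      + c * (norm ?e * norm ?w) + lambda_max (inertia Q) / 2 * (norm ?w)\<^sup>2"
    using J(2) cross(2) by (simp add: attitude_lyapunov_def)
qed

text \<open>Without cross term the attitude function is nonincreasing and dominates
  \<open>k_R * Psi\<close>. The hypothesis on \<open>e_Omega\<close> at time 0 makes its initial
  value less than \<open>k_R * \<psi>1\<close>.\<close>

lemma Psi_sublevel_invariant:
  assumes gains: "k_R Q > 0" "k_Omega Q > 0"
    and init: "(norm (e_Omega Q s 0))\<^sup>2 <
      2 / lambda_max (inertia Q) * k_R Q * (\<psi>1 - Psi (att s 0) (R_c Q s 0))"
    and t: "0 \<le> t" "ereal t < T"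
  shows "Psi (att s t) (R_c Q s t) < \<psi>1"
proof -
  let ?V = "attitude_lyapunov Q 0 s" and ?L = "lambda_max (inertia Q)"
  have sym: "transpose (inertia Q) = inertia Q" using inertia_pd by (simp add: symmetric_pos_def_def)
  have L: "?L > 0"
    using lambda_min_pos[OF inertia_pd] lambda_min_le_lambda_max[OF sym] by simp
  have dom: "ereal u < T" if "u \<le> t" for u using that t(2) by (meson ereal_less_eq(3) le_less_trans)
  have deriv: "\<exists>D. (?V has_vector_derivative D) (at u within {0..}) \<and> D \<le> 0" if u: "0 \<le> u" "u \<le> t" for u
  proof -
    obtain D where D: "(?V has_vector_derivative D) (at u within {0..})"
      "D \<le> - (z2 Q s u \<bullet> (W2 Q 0 *v z2 Q s u))"
      by (rule attitude_lyapunov_decay[OF u(1) dom[OF u(2)] gains order_refl])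
    have "0 \<le> z2 Q s u \<bullet> (W2 Q 0 *v z2 Q s u)"
      unfolding z2_def W2_def sym2_quadratic_form using gains by simp
    with D show ?thesis by (intro exI[of _ D]) simp
  qed
  have "?V t \<le> ?V 0 * exp (- 0 * t)"
  proof (rule exponential_decay[OF t(1)])
    show "continuous_on {0..t} ?V"
      by (rule continuous_on_if_within_derivatives) (use deriv in blast)
    fix u assume u: "0 < u" "u < t"
    then obtain D where "(?V has_vector_derivative D) (at u within {0..})" "D \<le> 0"
      using deriv[of u] by auto
    then show "\<exists>D. (?V has_real_derivative D) (at u) \<and> D \<le> - 0 * ?V u"
      using u(1) by (auto simp: has_real_derivative_at_within_atLeast)
  qed
  moreover have "k_R Q * Psi (att s t) (R_c Q s t) \<le> ?V t"
    using lambda_min_quadratic_form[OF sym, of "e_Omega Q s t"] lambda_min_pos[OF inertia_pd]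
    by (simp add: attitude_lyapunov_def) (meson order_trans zero_le_power2 less_imp_le mult_nonneg_nonneg)
  moreover have "?V 0 < k_R Q * \<psi>1"
  proof -
    have "?L * (norm (e_Omega Q s 0))\<^sup>2 < 2 * k_R Q * (\<psi>1 - Psi (att s 0) (R_c Q s 0))"
      using init L by (simp add: field_simps)
    then show ?thesis
      using lambda_max_quadratic_form[OF sym, of "e_Omega Q s 0"]
      by (simp add: attitude_lyapunov_def algebra_simps)
  qed
  ultimately have "k_R Q * Psi (att s t) (R_c Q s t) < k_R Q * \<psi>1" by simp
  then show ?thesis using gains(1) by simp
qed

end

section \<open>The Lyapunov function of the complete error\<close>

definition error_sq :: "quadrotor \<Rightarrow> trajectory \<Rightarrow> real \<Rightarrow> real" where
  "error_sq Q s t = (norm (z1 Q s t))\<^sup>2 + (norm (z2 Q s t))\<^sup>2"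

definition total_lyapunov :: "quadrotor \<Rightarrow> real \<Rightarrow> real \<Rightarrow> trajectory \<Rightarrow> real \<Rightarrow> real" where
  "total_lyapunov Q c1 c2 s t = translation_lyapunov Q (c1 / 2) s t + attitude_lyapunov Q c2 s t"

lemma norm_tracking_error: "(norm (tracking_error Q s t))\<^sup>2 = error_sq Q s t"
  by (simp add: tracking_error_def error_sq_def norm_Pair z1_def z2_def norm_vector2)

text \<open>As \<open>W1\<close> is affine in \<open>c\<close>, the two sides differ only by half of
  its constant part, the damping entry \<open>k_v * (1 - alpha)\<close>, which is
  nonnegative.\<close>

lemma W1_half:
  assumes "mass Q \<noteq> 0" "k_v Q * (1 - alpha \<psi>1) \<ge> 0"
  shows "1 / 2 * (vector [a, b] \<bullet> (W1 Q c \<psi>1 *v vector [a, b]))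
    \<le> vector [a, b] \<bullet> (W1 Q (c / 2) \<psi>1 *v vector [a, b])"
proof -
  have "vector [a, b] \<bullet> (W1 Q (c / 2) \<psi>1 *v vector [a, b])
      = 1 / 2 * (vector [a, b] \<bullet> (W1 Q c \<psi>1 *v vector [a, b])) + k_v Q * (1 - alpha \<psi>1) / 2 * b\<^sup>2"
    unfolding W1_def sym2_quadratic_form using assms(1) by (simp add: field_simps)
  moreover have "0 \<le> k_v Q * (1 - alpha \<psi>1) / 2 * b\<^sup>2"
    using assms by (intro mult_nonneg_nonneg) auto
  ultimately show ?thesis by linarith
qed

lemma norm2_mult_vec: "norm (A *v x) \<le> norm2 A * norm x"
  unfolding norm2_def by (intro onorm matrix_vector_mul_bounded_linear)

text \<open>The left side is the bilinear form of \<open>W12\<close>; \<open>w\<close> is absent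
  from it because the second column of \<open>W12\<close> vanishes.\<close>

lemma W12_cross_term:
  "r * (c / mass Q * B * a + (B + k_x Q * E) * b)
    \<le> norm (vector [a, b] :: real ^ 2) * (norm2 (W12 Q c B E) * norm (vector [r, w] :: real ^ 2))"
proof -
  have "r * (c / mass Q * B * a + (B + k_x Q * E) * b) =
      (vector [a, b] :: real ^ 2) \<bullet> (W12 Q c B E *v vector [r, w])"
    by (simp add: W12_def inner_vec_def matrix_vector_mult_def sum_2 algebra_simps)
  also have "\<dots> \<le> norm (vector [a, b] :: real ^ 2) * norm (W12 Q c B E *v vector [r, w])"
    by (rule norm_cauchy_schwarz)
  also have "\<dots> \<le> norm (vector [a, b] :: real ^ 2) * (norm2 (W12 Q c B E) * norm (vector [r, w] :: real ^ 2))"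
    by (intro mult_left_mono norm2_mult_vec) simp
  finally show ?thesis .
qed

context tracking_solution
begin

lemma total_lyapunov_decay:
  fixes B E c1 c2 \<psi>1 :: real
  defines "\<mu>1 \<equiv> lambda_min (W1 Q c1 \<psi>1)" and "\<mu>2 \<equiv> lambda_min (W2 Q c2)"
    and "n \<equiv> norm2 (W12 Q c1 B E)"
  assumes t: "0 \<le> t" "ereal t < T"
    and gains: "k_x Q > 0" "k_v Q > 0" "k_R Q > 0" "k_Omega Q > 0" "c1 > 0" "c2 > 0"
    and pos: "B > 0" "E > 0" "k_v Q * (1 - alpha \<psi>1) \<ge> 0" "\<mu>1 > 0"
    and Psi: "Psi (att s t) (R_c Q s t) \<le> \<psi>1" "\<psi>1 < 1"
    and ff: "norm (feedforward Q t) \<le> B" and ex: "norm (e_x Q s t) \<le> 2 * E"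
  obtains D where "(total_lyapunov Q c1 c2 s has_vector_derivative D) (at t within {0..})"
    and "D \<le> - (min (\<mu>1 / 4) (\<mu>2 - 4 * n\<^sup>2 / \<mu>1) * error_sq Q s t)"
proof -
  let ?a = "norm (e_x Q s t)" and ?b = "norm (e_v Q s t)" and ?r = "norm (e_R Q s t)"
  let ?z1 = "z1 Q s t" and ?z2 = "z2 Q s t"
  let ?\<delta> = "min (\<mu>1 / 4) (\<mu>2 - 4 * n\<^sup>2 / \<mu>1)"
  obtain D1 where D1: "(translation_lyapunov Q (c1 / 2) s has_vector_derivative D1) (at t within {0..})"
    "D1 \<le> - (?z1 \<bullet> (W1 Q (c1 / 2) \<psi>1 *v ?z1))
      + ?r * (c1 / 2 / mass Q * B * ?a + (B + k_x Q * (2 * E)) * ?b)"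
    using translation_lyapunov_decay[OF t gains(1,2) _ Psi ff ex, of "c1 / 2"] gains(5) by auto
  obtain D2 where D2: "(attitude_lyapunov Q c2 s has_vector_derivative D2) (at t within {0..})"
    "D2 \<le> - (?z2 \<bullet> (W2 Q c2 *v ?z2))"
    using attitude_lyapunov_decay[OF t gains(3,4), of c2] gains(6) by auto
  have deriv: "(total_lyapunov Q c1 c2 s has_vector_derivative D1 + D2) (at t within {0..})"
    unfolding total_lyapunov_def[abs_def] by (intro has_vector_derivative_add D1 D2)
  have "\<mu>1 * (norm ?z1)\<^sup>2 / 2 \<le> 1 / 2 * (?z1 \<bullet> (W1 Q c1 \<psi>1 *v ?z1))"
    using lambda_min_quadratic_form[of "W1 Q c1 \<psi>1" ?z1]
    by (simp add: \<mu>1_def W1_def transpose_sym2)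
  also have "\<dots> \<le> ?z1 \<bullet> (W1 Q (c1 / 2) \<psi>1 *v ?z1)"
    unfolding z1_def using mass_pos by (intro W1_half pos(3)) simp
  finally have W1: "\<mu>1 * (norm ?z1)\<^sup>2 / 2 \<le> ?z1 \<bullet> (W1 Q (c1 / 2) \<psi>1 *v ?z1)" .
  have W2: "\<mu>2 * (norm ?z2)\<^sup>2 \<le> ?z2 \<bullet> (W2 Q c2 *v ?z2)"
    using lambda_min_quadratic_form[of "W2 Q c2" ?z2]
    by (simp add: \<mu>2_def W2_def transpose_sym2)
  \<comment> \<open>Passing from the bound \<open>E\<close> to \<open>2 * E\<close> at most doubles
    the coupling, so \<open>W12\<close> can be kept with radius \<open>E\<close>.\<close>
  have "?r * (c1 / 2 / mass Q * B * ?a + (B + k_x Q * (2 * E)) * ?b)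
      \<le> ?r * (2 * (c1 / mass Q * B * ?a + (B + k_x Q * E) * ?b))"
  proof (intro mult_left_mono)
    define k where "k = c1 / mass Q * B * ?a"
    have "0 \<le> k" "0 \<le> B * ?b"
      using gains pos mass_pos by (simp_all add: k_def)
    moreover have k_half: "c1 / 2 / mass Q * B * ?a = k / 2" by (simp add: k_def)
    ultimately show "c1 / 2 / mass Q * B * ?a + (B + k_x Q * (2 * E)) * ?b
        \<le> 2 * (c1 / mass Q * B * ?a + (B + k_x Q * E) * ?b)"
      unfolding k_half k_def[symmetric] by (simp add: algebra_simps)
  qed simp
  also have "\<dots> = 2 * (?r * (c1 / mass Q * B * ?a + (B + k_x Q * E) * ?b))" by simp
  also have "\<dots> \<le> 2 * (norm ?z1 * (n * norm ?z2))"
    unfolding n_def z1_def z2_def by (rule mult_left_mono[OF W12_cross_term]) simp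
  \<comment> \<open>Young's inequality: of the available decay \<open>\<mu>1 / 2\<close> in
    \<open>z1\<close>, one half is spent on the coupling. The cost in \<open>z2\<close> is then
    exactly the quantity that the design condition on \<open>W2\<close> controls.\<close>
  also have "\<dots> \<le> \<mu>1 / 4 * (norm ?z1)\<^sup>2 + 4 * n\<^sup>2 / \<mu>1 * (norm ?z2)\<^sup>2"
  proof -
    have "0 \<le> (\<mu>1 / 2 * norm ?z1 - 2 * n * norm ?z2)\<^sup>2 / \<mu>1"
      using pos(4) by simp
    also have "\<dots> = \<mu>1 / 4 * (norm ?z1)\<^sup>2 + 4 * n\<^sup>2 / \<mu>1 * (norm ?z2)\<^sup>2 - 2 * (norm ?z1 * (n * norm ?z2))"
      using pos(4) by (simp add: power2_eq_square field_simps)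
    finally show ?thesis by simp
  qed
  finally have "D1 + D2 \<le> - (\<mu>1 / 4 * (norm ?z1)\<^sup>2 + (\<mu>2 - 4 * n\<^sup>2 / \<mu>1) * (norm ?z2)\<^sup>2)"
    using D1(2) D2(2) W1 W2 by (simp add: algebra_simps)
  also have "\<dots> \<le> - (?\<delta> * error_sq Q s t)"
  proof -
    have "?\<delta> * (norm ?z1)\<^sup>2 \<le> \<mu>1 / 4 * (norm ?z1)\<^sup>2"
      "?\<delta> * (norm ?z2)\<^sup>2 \<le> (\<mu>2 - 4 * n\<^sup>2 / \<mu>1) * (norm ?z2)\<^sup>2"
      by (intro mult_right_mono min.cobounded1 min.cobounded2 zero_le_power2)+
    then show ?thesis by (simp add: error_sq_def distrib_left)
  qed
  finally show ?thesis using deriv that by blast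
qed

lemma total_lyapunov_upper:
  assumes t: "0 \<le> t" "ereal t < T"
    and gains: "k_R Q > 0" "c1 > 0" "c2 > 0"
    and Psi: "Psi (att s t) (R_c Q s t) \<le> \<psi>1" "\<psi>1 < 1"
  shows "total_lyapunov Q c1 c2 s t \<le> lambda_max (M12 Q c1) * (norm (z1 Q s t))\<^sup>2
    + lambda_max (M22' Q c2 \<psi>1) * (norm (z2 Q s t))\<^sup>2"
proof -
  have half: "(1 / 2) *\<^sub>R (vector [vector [p, q], vector [q, r]] :: real ^ 2 ^ 2)
      = vector [vector [p / 2, q / 2], vector [q / 2, r / 2]]" for p q r :: real
    by (simp add: vec_eq_iff forall_2)
  have "translation_lyapunov Q (c1 / 2) s t \<le> z1 Q s t \<bullet> (M12 Q c1 *v z1 Q s t)"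
  proof -
    \<comment> \<open>\<open>M12\<close> carries the full weight \<open>c1\<close>, the Lyapunov
      function only half of it; this nonnegative product is the slack.\<close>
    have cross: "0 \<le> c1 * (norm (e_x Q s t) * norm (e_v Q s t))"
      using gains by simp
    then show ?thesis
      using translation_lyapunov_bounds(2)[of "c1 / 2" Q s t] gains
      unfolding z1_def M12_def half sym2_quadratic_form by simp (use cross in linarith)
  qed
  also have "\<dots> \<le> lambda_max (M12 Q c1) * (norm (z1 Q s t))\<^sup>2"
    by (rule lambda_max_quadratic_form) (simp add: M12_def half transpose_sym2)
  finally have 1: "translation_lyapunov Q (c1 / 2) s t \<le> lambda_max (M12 Q c1) * (norm (z1 Q s t))\<^sup>2" .
  have halve: "2 * k_R Q / (2 - \<psi>1) / 2 = k_R Q / (2 - \<psi>1)"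
    using Psi(2) by (simp add: field_simps)
  have "attitude_lyapunov Q c2 s t \<le> z2 Q s t \<bullet> (M22' Q c2 \<psi>1 *v z2 Q s t)"
    using attitude_lyapunov_bounds(2)[OF t gains(1) _ Psi, of c2] gains
    unfolding z2_def M22'_def half halve sym2_quadratic_form by simp
  also have "\<dots> \<le> lambda_max (M22' Q c2 \<psi>1) * (norm (z2 Q s t))\<^sup>2"
    by (rule lambda_max_quadratic_form) (simp add: M22'_def half transpose_sym2)
  finally show ?thesis using 1 by (simp add: total_lyapunov_def)
qed

lemma e_x_barrier:
  assumes gains: "k_x Q > 0" "k_R Q > 0" "c1 > 0" "c2 > 0" "E > 0"
    and c1: "c1\<^sup>2 < k_x Q * mass Q" and c2: "c2\<^sup>2 < k_R Q * lambda_min (inertia Q)"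
    and t: "0 \<le> t" "ereal t < T" and V: "total_lyapunov Q c1 c2 s t < 1 / 2 * k_x Q * E\<^sup>2"
  shows "norm (e_x Q s t) < 2 * E"
proof -
  let ?a = "norm (e_x Q s t)" and ?b = "norm (e_v Q s t)"
  have "0 \<le> attitude_lyapunov Q c2 s t"
  proof -
    let ?r = "norm (e_R Q s t)" and ?w = "norm (e_Omega Q s t)"
    have "0 \<le> k_R Q / 2 * ?r\<^sup>2 + 2 * (- (c2 / 2)) * (?r * ?w) + lambda_min (inertia Q) / 2 * ?w\<^sup>2"
      using quadratic_form2_pos[of "k_R Q / 2" "- (c2 / 2)" "lambda_min (inertia Q) / 2" ?r ?w]
        gains(2) c2 by (cases "?r = 0 \<and> ?w = 0") (auto simp: power_divide intro: less_imp_le)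
    then show ?thesis using attitude_lyapunov_bounds(1)[OF t gains(2), of c2] gains(4) by simp
  qed
  then have "translation_lyapunov Q (c1 / 2) s t < 1 / 2 * k_x Q * E\<^sup>2"
    using V by (simp add: total_lyapunov_def)
  then have "k_x Q / 2 * ?a\<^sup>2 - c1 / 2 * (?a * ?b) + mass Q / 2 * ?b\<^sup>2 < 1 / 2 * k_x Q * E\<^sup>2"
    using translation_lyapunov_bounds(1)[of "c1 / 2" Q s t] gains(3) by simp
  \<comment> \<open>The share \<open>k_x / 8\<close> is reserved to absorb the cross term; with it
    the determinant condition reads exactly \<open>c1^2 < k_x * mass\<close>.\<close>
  moreover have "3 / 8 * k_x Q * ?a\<^sup>2 \<le> k_x Q / 2 * ?a\<^sup>2 - c1 / 2 * (?a * ?b) + mass Q / 2 * ?b\<^sup>2"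
  proof -
    have "0 \<le> k_x Q / 8 * ?a\<^sup>2 + 2 * (- (c1 / 4)) * (?a * ?b) + mass Q / 2 * ?b\<^sup>2"
      using quadratic_form2_pos[of "k_x Q / 8" "- (c1 / 4)" "mass Q / 2" ?a ?b]
        gains(1) c1 by (cases "?a = 0 \<and> ?b = 0") (auto simp: power_divide intro: less_imp_le)
    then show ?thesis by (simp add: algebra_simps)
  qed
  ultimately have "k_x Q * (3 / 8 * ?a\<^sup>2) < k_x Q * (1 / 2 * E\<^sup>2)" by (simp add: mult_ac)
  then have "3 / 8 * ?a\<^sup>2 < 1 / 2 * E\<^sup>2" using gains(1) by simp
  \<comment> \<open>The estimate gives \<open>?a^2 < 4/3 * E^2\<close>; it is relaxed to the radius
    \<open>2 * E\<close> used in \<open>total_lyapunov_decay\<close>.\<close>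
  then have "?a\<^sup>2 < 4 * E\<^sup>2" using zero_less_power[OF gains(5), of 2] by linarith
  then have "?a\<^sup>2 < (2 * E)\<^sup>2" by (simp add: power_mult_distrib)
  then show ?thesis by (rule power2_less_imp_less) (use gains(5) in simp)
qed

end


section \<open>Exponential stability\<close>

lemma quadratic_form2_coercive:
  fixes p q r :: real
  assumes "p > 0" "q\<^sup>2 < p * r"
  obtains \<kappa> where "\<kappa> > 0" and "\<And>a b. \<kappa> * (a\<^sup>2 + b\<^sup>2) \<le> p * a\<^sup>2 + 2 * q * (a * b) + r * b\<^sup>2"
proof
  let ?A = "vector [vector [p, q], vector [q, r]] :: real ^ 2 ^ 2"
  show "lambda_min ?A > 0"
    by (intro lambda_min_pos symmetric_pos_def_sym2 assms)
  show "lambda_min ?A * (a\<^sup>2 + b\<^sup>2) \<le> p * a\<^sup>2 + 2 * q * (a * b) + r * b\<^sup>2" for a b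
    using lambda_min_quadratic_form[OF transpose_sym2, of p q r "vector [a, b]"]
    unfolding sym2_quadratic_form norm_vector2 .
qed

text \<open>The upper bound on \<open>c\<close> is the condition that the determinant of
  \<open>W1\<close> be positive, cleared of the common factor
  \<open>c / (4 * mass^2)\<close>.\<close>

lemma lambda_min_W1_pos:
  assumes m: "mass Q > 0" and k: "k_x Q > 0" "k_v Q > 0" "c > 0" and \<alpha>: "0 \<le> alpha \<psi>1" "alpha \<psi>1 < 1"
    and c: "c < 4 * mass Q * k_x Q * k_v Q * (1 - alpha \<psi>1)\<^sup>2 /
      ((k_v Q)\<^sup>2 * (1 + alpha \<psi>1)\<^sup>2 + 4 * mass Q * k_x Q * (1 - alpha \<psi>1))"
  shows "lambda_min (W1 Q c \<psi>1) > 0"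
proof -
  let ?\<alpha> = "alpha \<psi>1" and ?m = "mass Q"
  let ?p = "c * k_x Q / ?m * (1 - ?\<alpha>)" and ?q = "- (c * k_v Q / (2 * ?m)) * (1 + ?\<alpha>)"
    and ?r = "k_v Q * (1 - ?\<alpha>) - c"
  have "0 < (k_v Q)\<^sup>2 * (1 + ?\<alpha>)\<^sup>2 + 4 * ?m * k_x Q * (1 - ?\<alpha>)"
    using m k \<alpha> by (intro add_pos_pos mult_pos_pos) auto
  then have "c * ((k_v Q)\<^sup>2 * (1 + ?\<alpha>)\<^sup>2 + 4 * ?m * k_x Q * (1 - ?\<alpha>)) < 4 * ?m * k_x Q * k_v Q * (1 - ?\<alpha>)\<^sup>2"
    using c by (simp add: pos_less_divide_eq)
  then have "0 < c / (4 * ?m\<^sup>2) * (4 * ?m * k_x Q * k_v Q * (1 - ?\<alpha>)\<^sup>2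
      - c * ((k_v Q)\<^sup>2 * (1 + ?\<alpha>)\<^sup>2 + 4 * ?m * k_x Q * (1 - ?\<alpha>)))"
    using k m by (intro mult_pos_pos) auto
  also have "\<dots> = ?p * ?r - ?q\<^sup>2"
    using m by (simp add: power2_eq_square field_simps)
  finally have "?q\<^sup>2 < ?p * ?r" by simp
  moreover have "?p > 0" using m k \<alpha> by simp
  ultimately show ?thesis
    unfolding W1_def by (intro lambda_min_pos symmetric_pos_def_sym2)
qed

context tracking_solution
begin

text \<open>Once \<open>Psi\<close> and \<open>e_x\<close> are confined, the derivative estimate
  holds on the whole interval, and comparing the Lyapunov function with the squared error from both
  sides turns it into exponential decay. All constants are fixed independently of the trajectory, as
  uniform stability demands.\<close>

lemma tracking_error_decay:
  fixes B E c1 c2 \<psi>1 :: real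
  defines "\<delta> \<equiv> min (lambda_min (W1 Q c1 \<psi>1) / 4)
      (lambda_min (W2 Q c2) - 4 * (norm2 (W12 Q c1 B E))\<^sup>2 / lambda_min (W1 Q c1 \<psi>1))"
  assumes gains: "k_x Q > 0" "k_v Q > 0" "k_R Q > 0" "k_Omega Q > 0" "c1 > 0" "c2 > 0"
    and pos: "B > 0" "E > 0" "k_v Q * (1 - alpha \<psi>1) \<ge> 0" "\<psi>1 < 1"
    and W1: "lambda_min (W1 Q c1 \<psi>1) > 0" and \<delta>: "\<delta> > 0"
    and ff: "\<And>t. 0 \<le> t \<Longrightarrow> norm (feedforward Q t) \<le> B"
    and c1: "c1\<^sup>2 < k_x Q * mass Q" and c2: "c2\<^sup>2 < k_R Q * lambda_min (inertia Q)"
    and \<kappa>: "\<kappa> > 0"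
      "\<And>a b. \<kappa> * (a\<^sup>2 + b\<^sup>2) \<le> k_x Q / 2 * a\<^sup>2 - c1 / 2 * (a * b) + mass Q / 2 * b\<^sup>2"
      "\<And>a b. \<kappa> * (a\<^sup>2 + b\<^sup>2) \<le> k_R Q / 2 * a\<^sup>2 - c2 * (a * b) + lambda_min (inertia Q) / 2 * b\<^sup>2"
    and K: "K > 0" "lambda_max (M12 Q c1) \<le> K" "lambda_max (M22' Q c2 \<psi>1) \<le> K"
    and init: "norm (e_x Q s 0) < E"
      "(norm (e_Omega Q s 0))\<^sup>2 <
        2 / lambda_max (inertia Q) * k_R Q * (\<psi>1 - Psi (att s 0) (R_c Q s 0))"
      "lambda_max (M12 Q c1) * (norm (z1 Q s 0))\<^sup>2
        + lambda_max (M22' Q c2 \<psi>1) * (norm (z2 Q s 0))\<^sup>2 < 1 / 2 * k_x Q * E\<^sup>2"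
    and t: "0 < t" "ereal t < T"
  shows "norm (tracking_error Q s t)
    \<le> sqrt (K / \<kappa>) * norm (tracking_error Q s 0) * exp (- (\<delta> / (2 * K)) * t)"
proof -
  let ?V = "total_lyapunov Q c1 c2 s" and ?N = "error_sq Q s"
  have dom: "ereal u < T" if "u \<le> t" for u using that t(2) by (meson ereal_less_eq(3) le_less_trans)
  have Psi: "Psi (att s u) (R_c Q s u) \<le> \<psi>1" if "0 \<le> u" "u \<le> t" for u
    using Psi_sublevel_invariant[OF gains(3,4) init(2) that(1) dom[OF that(2)]] by simp
  have N: "0 \<le> ?N u" for u by (simp add: error_sq_def)
  have deriv: "\<exists>D. (?V has_vector_derivative D) (at u within {0..}) \<and> D \<le> - (\<delta> * ?N u)"
    if u: "0 \<le> u" "u \<le> t" "norm (e_x Q s u) \<le> 2 * E" for u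
    using total_lyapunov_decay[OF u(1) dom[OF u(2)] gains pos(1-3) W1 Psi[OF u(1,2)] pos(4) ff[OF u(1)] u(3)]
    unfolding \<delta>_def by metis
  have V_cont: "continuous_on {0..u} ?V" if "u \<le> t" "\<And>r. 0 \<le> r \<Longrightarrow> r \<le> u \<Longrightarrow> norm (e_x Q s r) \<le> 2 * E" for u
    by (rule continuous_on_if_within_derivatives) (use deriv that in \<open>meson order_trans\<close>)
  have V_deriv: "\<exists>D. (?V has_real_derivative D) (at u) \<and> D \<le> - (\<delta> * ?N u)"
    if "0 < u" "u \<le> t" "norm (e_x Q s u) \<le> 2 * E" for u
    using deriv[of u] that by (auto simp: has_real_derivative_at_within_atLeast)
  have V0: "?V 0 < 1 / 2 * k_x Q * E\<^sup>2"
    using total_lyapunov_upper[OF order_refl dom gains(3,5,6) Psi pos(4)] init(3) t(1) by simp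
  have ex_cont: "continuous_on {0..u} (\<lambda>r. norm (e_x Q s r))" if "u \<le> t" for u
    by (intro continuous_on_norm continuous_on_if_within_derivatives)
      (use e_x_deriv dom that in \<open>meson order_trans\<close>)
  have ex: "norm (e_x Q s u) < 2 * E" if u: "0 \<le> u" "u \<le> t" for u
  proof (rule barrier_on_interval[OF ex_cont[OF u(2)] u(1)])
    show "norm (e_x Q s 0) < 2 * E" using init(1) pos(2) by simp
    fix r assume r: "0 < r" "r \<le> u" and below: "\<And>q. 0 \<le> q \<Longrightarrow> q < r \<Longrightarrow> norm (e_x Q s q) < 2 * E"
    have "r \<le> t" using r u by simp
    \<comment> \<open>The strict bound before \<open>r\<close> passes to a weak one at
      \<open>r\<close> by continuity. This is why the decay estimate is stated for the closed ball:
      it makes the Lyapunov function continuous up to \<open>r\<close>.\<close>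
    have at_r: "norm (e_x Q s r) \<le> 2 * E"
    proof (rule continuous_le_on_closure[where S = "{0..<r}" and x = r])
      show "continuous_on (closure {0..<r}) (\<lambda>r. norm (e_x Q s r))"
        using ex_cont[OF \<open>r \<le> t\<close>] r(1) by simp
    qed (use r below in \<open>auto intro: less_imp_le\<close>)
    have le: "norm (e_x Q s q) \<le> 2 * E" if "0 \<le> q" "q \<le> r" for q
      using below[of q] at_r that by (cases "q = r") auto
    \<comment> \<open>Rate 0 suffices: monotonicity on \<open>{0..r}\<close> keeps the function
      below the barrier level and thereby restores the strict bound at \<open>r\<close>.\<close>
    have "?V r \<le> ?V 0 * exp (- 0 * r)"
    proof (rule exponential_decay)
      show "continuous_on {0..r} ?V" by (rule V_cont[OF \<open>r \<le> t\<close> le])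
      fix q assume "0 < q" "q < r"
      then obtain D where "(?V has_real_derivative D) (at q)" "D \<le> - (\<delta> * ?N q)"
        using V_deriv[of q] le[of q] \<open>r \<le> t\<close> by auto
      moreover have "0 \<le> \<delta> * ?N q" using \<delta> N by simp
      ultimately show "\<exists>D. (?V has_real_derivative D) (at q) \<and> D \<le> - 0 * ?V q"
        by (intro exI[of _ D]) simp
    qed (use r in simp)
    then have "?V r < 1 / 2 * k_x Q * E\<^sup>2" using V0 by simp
    then show "norm (e_x Q s r) < 2 * E"
      using r(1) dom[OF \<open>r \<le> t\<close>]
      by (intro e_x_barrier[OF gains(1,3,5,6) pos(2) c1 c2]) auto
  qed
  have upper: "?V u \<le> K * ?N u" if u: "0 \<le> u" "u \<le> t" for u
  proof -
    have "?V u \<le> lambda_max (M12 Q c1) * (norm (z1 Q s u))\<^sup>2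
        + lambda_max (M22' Q c2 \<psi>1) * (norm (z2 Q s u))\<^sup>2"
      by (rule total_lyapunov_upper[OF u(1) dom[OF u(2)] gains(3,5,6) Psi[OF u] pos(4)])
    also have "\<dots> \<le> K * (norm (z1 Q s u))\<^sup>2 + K * (norm (z2 Q s u))\<^sup>2"
      by (intro add_mono mult_right_mono K zero_le_power2)
    finally show ?thesis by (simp add: error_sq_def distrib_left)
  qed
  have lower: "\<kappa> * ?N t \<le> ?V t"
  proof -
    have "\<kappa> * (norm (z1 Q s t))\<^sup>2 \<le> translation_lyapunov Q (c1 / 2) s t"
      unfolding z1_def norm_vector2
      using \<kappa>(2) translation_lyapunov_bounds(1)[of "c1 / 2" Q s t] gains(5)
      by (meson order_trans less_imp_le half_gt_zero)
    moreover have "\<kappa> * (norm (z2 Q s t))\<^sup>2 \<le> attitude_lyapunov Q c2 s t"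
      unfolding z2_def norm_vector2
      using \<kappa>(3) attitude_lyapunov_bounds(1)[of t c2] t gains(3,6)
      by (meson order_trans less_imp_le)
    ultimately show ?thesis by (simp add: error_sq_def total_lyapunov_def distrib_left)
  qed
  have "?V t \<le> ?V 0 * exp (- (\<delta> / K) * t)"
  proof (rule exponential_decay)
    show "continuous_on {0..t} ?V" using ex by (intro V_cont) (auto intro: less_imp_le)
    fix u assume u: "0 < u" "u < t"
    then obtain D where D: "(?V has_real_derivative D) (at u)" "D \<le> - (\<delta> * ?N u)"
      using V_deriv[of u] ex[of u] by auto
    have "\<delta> / K * ?V u \<le> \<delta> / K * (K * ?N u)"
      using upper[of u] u \<delta> K(1) by (intro mult_left_mono) auto
    also have "\<dots> = \<delta> * ?N u" using K(1) by simp
    finally have "D \<le> - (\<delta> / K) * ?V u" using D(2) by simp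
    with D(1) show "\<exists>D. (?V has_real_derivative D) (at u) \<and> D \<le> - (\<delta> / K) * ?V u" by blast
  qed (use t in simp)
  also have "\<dots> \<le> K * ?N 0 * exp (- (\<delta> / K) * t)"
    using upper[of 0] t(1) by (intro mult_right_mono) auto
  finally have "\<kappa> * ?N t \<le> K * ?N 0 * exp (- (\<delta> / K) * t)" using lower by simp
  then have "?N t \<le> K * ?N 0 * exp (- (\<delta> / K) * t) / \<kappa>"
    using \<kappa>(1) by (simp add: pos_le_divide_eq mult.commute)
  \<comment> \<open>The squared error decays at rate \<open>\<delta> / K\<close>, hence the error
    itself at half that rate.\<close>
  also have "\<dots> = (sqrt (K / \<kappa>) * norm (tracking_error Q s 0) * exp (- (\<delta> / (2 * K)) * t))\<^sup>2"
  proof -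
    have "(sqrt (K / \<kappa>))\<^sup>2 = K / \<kappa>" using K(1) \<kappa>(1) by simp
    moreover have "(exp (- (\<delta> / (2 * K)) * t))\<^sup>2 = exp (- (\<delta> / K) * t)"
      by (simp flip: exp_double)
    ultimately show ?thesis by (simp only: power_mult_distrib norm_tracking_error) simp
  qed
  finally show ?thesis
    unfolding norm_tracking_error[symmetric]
    by (rule power2_le_imp_le) (use K(1) \<kappa>(1) in simp)
qed

end

section \<open>From small initial errors to the region of attraction\<close>

lemma alpha_bounds:
  assumes "0 < \<psi>1" "\<psi>1 < 1"
  shows "0 \<le> alpha \<psi>1" "alpha \<psi>1 < 1"
proof -
  have "0 < (1 - \<psi>1)\<^sup>2" using assms by simp
  then have "\<psi>1 * (2 - \<psi>1) < 1" by (simp add: power2_eq_square algebra_simps)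
  then show "alpha \<psi>1 < 1" by (simp add: alpha_def)
  show "0 \<le> alpha \<psi>1" using assms by (simp add: alpha_def)
qed

text \<open>For \<open>Psi\<close> below 1 the factor \<open>2 - Psi\<close> exceeds 1, so
  \<open>Psi\<close> is at most the squared norm of \<open>e_R\<close> and hence of the complete
  error. Each smallness condition then yields one of the four conditions on the initial
  state.\<close>

lemma (in tracking_solution) small_error_in_region:
  assumes T: "0 < T" and gains: "k_R Q > 0" and K: "K > 0"
    "lambda_max (M12 Q c1) \<le> K" "lambda_max (M22' Q c2 \<psi>1) \<le> K"
    and Psi: "Psi (att s 0) (R_c Q s 0) < 1" and E: "E > 0"
    and small: "(norm (tracking_error Q s 0))\<^sup>2 < \<psi>1" "(norm (tracking_error Q s 0))\<^sup>2 < E\<^sup>2"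
      "(1 + 2 / lambda_max (inertia Q) * k_R Q) * (norm (tracking_error Q s 0))\<^sup>2
        < 2 / lambda_max (inertia Q) * k_R Q * \<psi>1"
      "K * (norm (tracking_error Q s 0))\<^sup>2 < 1 / 2 * k_x Q * E\<^sup>2"
  shows "Psi (att s 0) (R_c Q s 0) < \<psi>1"
    and "norm (e_x Q s 0) < E"
    and "(norm (e_Omega Q s 0))\<^sup>2 <
      2 / lambda_max (inertia Q) * k_R Q * (\<psi>1 - Psi (att s 0) (R_c Q s 0))"
    and "lambda_max (M12 Q c1) * (norm (z1 Q s 0))\<^sup>2
      + lambda_max (M22' Q c2 \<psi>1) * (norm (z2 Q s 0))\<^sup>2 < 1 / 2 * k_x Q * E\<^sup>2"
proof -
  let ?N = "(norm (tracking_error Q s 0))\<^sup>2" and ?\<Psi> = "Psi (att s 0) (R_c Q s 0)"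
  let ?\<mu> = "2 / lambda_max (inertia Q) * k_R Q"
  have t0: "(0::real) \<le> 0" "ereal 0 < T" using T by (simp_all add: zero_ereal_def)
  have N: "?N = (norm (e_x Q s 0))\<^sup>2 + (norm (e_v Q s 0))\<^sup>2 + (norm (e_R Q s 0))\<^sup>2 + (norm (e_Omega Q s 0))\<^sup>2"
    by (simp add: tracking_error_def norm_Pair)
  have "?\<Psi> * 1 \<le> ?\<Psi> * (2 - ?\<Psi>)"
    using Psi Psi_bounds[OF t0] by (intro mult_left_mono) auto
  then have "?\<Psi> \<le> (norm (e_R Q s 0))\<^sup>2" by (simp add: norm_e_R_sq[OF t0])
  also have "\<dots> \<le> ?N" by (simp add: N)
  finally have \<Psi>: "?\<Psi> \<le> ?N" .
  then show "?\<Psi> < \<psi>1" using small(1) by simp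
  have "(norm (e_x Q s 0))\<^sup>2 < E\<^sup>2" using small(2) unfolding N by (smt (verit) zero_le_power2)
  then show "norm (e_x Q s 0) < E" by (rule power2_less_imp_less) (use E in simp)
  have "transpose (inertia Q) = inertia Q" using inertia_pd by (simp add: symmetric_pos_def_def)
  then have "lambda_max (inertia Q) > 0"
    using lambda_min_pos[OF inertia_pd] lambda_min_le_lambda_max by (meson less_le_trans)
  then have "?\<mu> * ?\<Psi> \<le> ?\<mu> * ?N" using gains \<Psi> by (intro mult_left_mono) auto
  moreover have "(norm (e_Omega Q s 0))\<^sup>2 \<le> ?N" by (simp add: N)
  moreover have "?N + ?\<mu> * ?N < ?\<mu> * \<psi>1" using small(3) by (simp only: distrib_right mult_1)
  ultimately show "(norm (e_Omega Q s 0))\<^sup>2 < ?\<mu> * (\<psi>1 - ?\<Psi>)"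
    unfolding right_diff_distrib by linarith
  have "lambda_max (M12 Q c1) * (norm (z1 Q s 0))\<^sup>2
      + lambda_max (M22' Q c2 \<psi>1) * (norm (z2 Q s 0))\<^sup>2
      \<le> K * (norm (z1 Q s 0))\<^sup>2 + K * (norm (z2 Q s 0))\<^sup>2"
    by (intro add_mono mult_right_mono K zero_le_power2)
  also have "\<dots> = K * ?N" unfolding norm_tracking_error error_sq_def by (simp add: distrib_left)
  finally show "lambda_max (M12 Q c1) * (norm (z1 Q s 0))\<^sup>2
      + lambda_max (M22' Q c2 \<psi>1) * (norm (z2 Q s 0))\<^sup>2 < 1 / 2 * k_x Q * E\<^sup>2"
    using small(4) by simp
qed

theorem proposition3:
  fixes Q :: quadrotor and B ex_max \<psi>1 c1 c2 :: real
  assumes "mass Q > 0" and "gravity Q > 0" and "symmetric_pos_def (inertia Q)"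
    and "smooth_signal (x_d Q)"
    and "B > 0" and "\<forall>t\<ge>0. norm (feedforward Q t) < B"
    and "ex_max > 0"
    and "0 < \<psi>1" and "\<psi>1 < 1"
    and "k_x Q > 0" and "k_v Q > 0" and "k_R Q > 0" and "k_Omega Q > 0"
    and "c1 > 0" and "c2 > 0"
    and "c1 < Min {k_v Q * (1 - alpha \<psi>1),
                   4 * mass Q * k_x Q * k_v Q * (1 - alpha \<psi>1)\<^sup>2 /
                     ((k_v Q)\<^sup>2 * (1 + alpha \<psi>1)\<^sup>2 + 4 * mass Q * k_x Q * (1 - alpha \<psi>1)),
                   sqrt (k_x Q * mass Q)}"
    and "c2 < Min {k_Omega Q,
                   4 * k_Omega Q * k_R Q * (lambda_min (inertia Q))\<^sup>2 /
                     ((k_Omega Q)\<^sup>2 * lambda_max (inertia Q)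
                      + 4 * k_R Q * (lambda_min (inertia Q))\<^sup>2),
                   sqrt (k_R Q * lambda_min (inertia Q))}"
    and "lambda_min (W2 Q c2) > 4 * (norm2 (W12 Q c1 B ex_max))\<^sup>2 / lambda_min (W1 Q c1 \<psi>1)"
  shows "zero_exponentially_stable Q \<and>
    exponentially_stable_from Q
      {s. Psi (att s 0) (R_c Q s 0) < \<psi>1 \<and>
          Psi (att s 0) (R_c Q s 0) < 1 \<and>
          norm (e_x Q s 0) < ex_max \<and>
          (norm (e_Omega Q s 0))\<^sup>2 <
            2 / lambda_max (inertia Q) * k_R Q * (\<psi>1 - Psi (att s 0) (R_c Q s 0)) \<and>
          lambda_max (M12 Q c1) * (norm (z1 Q s 0))\<^sup>2
            + lambda_max (M22' Q c2 \<psi>1) * (norm (z2 Q s 0))\<^sup>2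
            < 1 / 2 * k_x Q * ex_max\<^sup>2}"
proof -
  let ?n = "norm2 (W12 Q c1 B ex_max)" and ?\<mu> = "lambda_min (W1 Q c1 \<psi>1)"
  let ?L = "lambda_max (inertia Q)" and ?l = "lambda_min (inertia Q)"
  define \<delta> where "\<delta> = min (?\<mu> / 4) (lambda_min (W2 Q c2) - 4 * ?n\<^sup>2 / ?\<mu>)"
  \<comment> \<open>Including 1 in the maximum makes \<open>K\<close> positive without a discussion
    of the signs of the two eigenvalues.\<close>
  define K where "K = max 1 (max (lambda_max (M12 Q c1)) (lambda_max (M22' Q c2 \<psi>1)))"
  note \<alpha> = alpha_bounds[OF \<open>0 < \<psi>1\<close> \<open>\<psi>1 < 1\<close>]
  have c1: "c1 < 4 * mass Q * k_x Q * k_v Q * (1 - alpha \<psi>1)\<^sup>2 /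
      ((k_v Q)\<^sup>2 * (1 + alpha \<psi>1)\<^sup>2 + 4 * mass Q * k_x Q * (1 - alpha \<psi>1))"
    "c1 < sqrt (k_x Q * mass Q)"
    using assms(16) by simp_all
  have c2: "c2 < sqrt (k_R Q * ?l)" using assms(17) by simp
  have "transpose (inertia Q) = inertia Q"
    using \<open>symmetric_pos_def (inertia Q)\<close> by (simp add: symmetric_pos_def_def)
  then have l: "?l > 0" and L: "?L > 0"
    using lambda_min_pos[OF \<open>symmetric_pos_def (inertia Q)\<close>] lambda_min_le_lambda_max
    by (simp, meson less_le_trans)
  have \<mu>: "?\<mu> > 0"
    by (rule lambda_min_W1_pos) (use assms \<alpha> c1 in simp_all)
  have \<delta>: "\<delta> > 0" using \<mu> assms(18) by (simp add: \<delta>_def)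
  have K: "K > 0" "lambda_max (M12 Q c1) \<le> K" "lambda_max (M22' Q c2 \<psi>1) \<le> K"
    by (simp_all add: K_def)
  have sq: "c\<^sup>2 < x" if "0 < c" "c < sqrt x" for c x :: real
  proof -
    have "0 \<le> x" using less_trans[OF that] by simp
    then show ?thesis using power_strict_mono[OF that(2), of 2] that(1) by simp
  qed
  have c1': "c1\<^sup>2 < k_x Q * mass Q" and c2': "c2\<^sup>2 < k_R Q * ?l"
    using sq c1(2) c2 \<open>c1 > 0\<close> \<open>c2 > 0\<close> by blast+
  have "0 < k_x Q * mass Q" using \<open>k_x Q > 0\<close> \<open>mass Q > 0\<close> by simp
  \<comment> \<open>The determinant condition for the translational form whose half cross
    coefficient is \<open>c1 / 4\<close>.\<close>
  with c1' have c1'': "c1\<^sup>2 < k_x Q * mass Q * 4" by linarith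
  obtain \<kappa>1 where \<kappa>1: "\<kappa>1 > 0"
    "\<And>a b. \<kappa>1 * (a\<^sup>2 + b\<^sup>2) \<le> k_x Q / 2 * a\<^sup>2 + 2 * (- (c1 / 4)) * (a * b) + mass Q / 2 * b\<^sup>2"
    by (rule quadratic_form2_coercive[of "k_x Q / 2" "- (c1 / 4)" "mass Q / 2"])
      (use \<open>k_x Q > 0\<close> c1'' in \<open>auto simp: power_divide\<close>)
  obtain \<kappa>2 where \<kappa>2: "\<kappa>2 > 0"
    "\<And>a b. \<kappa>2 * (a\<^sup>2 + b\<^sup>2) \<le> k_R Q / 2 * a\<^sup>2 + 2 * (- (c2 / 2)) * (a * b) + ?l / 2 * b\<^sup>2"
    by (rule quadratic_form2_coercive[of "k_R Q / 2" "- (c2 / 2)" "?l / 2"])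
      (use \<open>k_R Q > 0\<close> c2' in \<open>auto simp: power_divide\<close>)
  define \<kappa> where "\<kappa> = min \<kappa>1 \<kappa>2"
  have \<kappa>: "\<kappa> > 0"
    "\<kappa> * (a\<^sup>2 + b\<^sup>2) \<le> k_x Q / 2 * a\<^sup>2 - c1 / 2 * (a * b) + mass Q / 2 * b\<^sup>2"
    "\<kappa> * (a\<^sup>2 + b\<^sup>2) \<le> k_R Q / 2 * a\<^sup>2 - c2 * (a * b) + ?l / 2 * b\<^sup>2" for a b
  proof -
    have "\<kappa> * (a\<^sup>2 + b\<^sup>2) \<le> \<kappa>1 * (a\<^sup>2 + b\<^sup>2)" "\<kappa> * (a\<^sup>2 + b\<^sup>2) \<le> \<kappa>2 * (a\<^sup>2 + b\<^sup>2)"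
      unfolding \<kappa>_def by (intro mult_right_mono; simp)+
    then show "\<kappa> * (a\<^sup>2 + b\<^sup>2) \<le> k_x Q / 2 * a\<^sup>2 - c1 / 2 * (a * b) + mass Q / 2 * b\<^sup>2"
      "\<kappa> * (a\<^sup>2 + b\<^sup>2) \<le> k_R Q / 2 * a\<^sup>2 - c2 * (a * b) + ?l / 2 * b\<^sup>2"
      using \<kappa>1(2)[of a b] \<kappa>2(2)[of a b] by simp_all
  qed (use \<kappa>1 \<kappa>2 in \<open>simp add: \<kappa>_def\<close>)
  let ?D = "{s. Psi (att s 0) (R_c Q s 0) < \<psi>1 \<and>
          Psi (att s 0) (R_c Q s 0) < 1 \<and>
          norm (e_x Q s 0) < ex_max \<and>
          (norm (e_Omega Q s 0))\<^sup>2 < 2 / ?L * k_R Q * (\<psi>1 - Psi (att s 0) (R_c Q s 0)) \<and>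
          lambda_max (M12 Q c1) * (norm (z1 Q s 0))\<^sup>2
            + lambda_max (M22' Q c2 \<psi>1) * (norm (z2 Q s 0))\<^sup>2 < 1 / 2 * k_x Q * ex_max\<^sup>2}"
  have sol: "tracking_solution Q T s" if "closed_loop Q T s" for T s
    using that assms by unfold_locales
  have decay: "norm (tracking_error Q s t)
      \<le> sqrt (K / \<kappa>) * norm (tracking_error Q s 0) * exp (- (\<delta> / (2 * K)) * t)"
    if "closed_loop Q T s" "s \<in> ?D" "0 < t" "ereal t < T" for T s t
    unfolding \<delta>_def
    by (rule tracking_solution.tracking_error_decay[OF sol[OF that(1)], where B = B and E = ex_max])
      (use assms \<mu> \<delta> K \<kappa> c1' c2' \<alpha> that in \<open>auto simp: \<delta>_def intro: less_imp_le\<close>)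
  have ab: "0 < sqrt (K / \<kappa>)" "0 < \<delta> / (2 * K)" using K \<delta> \<kappa>(1) by simp_all
  have region: "exponentially_stable_from Q ?D"
    unfolding exponentially_stable_from_def
    by (rule exI[of _ "sqrt (K / \<kappa>)"], rule exI[of _ "\<delta> / (2 * K)"],
        intro conjI ab allI impI) (elim conjE, rule decay)
  \<comment> \<open>The four entries are the thresholds for the squared error in the smallness
    conditions of \<open>small_error_in_region\<close>, so the radius of the neighbourhood is
    \<open>sqrt \<eta>\<close>.\<close>
  define \<eta> where "\<eta> = Min {\<psi>1, ex_max\<^sup>2,
      2 / ?L * k_R Q * \<psi>1 / (1 + 2 / ?L * k_R Q), 1 / 2 * k_x Q * ex_max\<^sup>2 / K}"
  have gain_pos: "0 < 2 / ?L * k_R Q" using L assms by simp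
  then have "0 < 2 / ?L * k_R Q * \<psi>1 / (1 + 2 / ?L * k_R Q)"
    using L \<open>0 < \<psi>1\<close> \<open>k_R Q > 0\<close>
    by (intro divide_pos_pos mult_pos_pos add_pos_pos) simp_all
  then have "\<eta> > 0"
    using \<open>0 < \<psi>1\<close> \<open>ex_max > 0\<close> \<open>k_x Q > 0\<close> K(1) by (simp add: \<eta>_def)
  have near: "s \<in> ?D" if "0 < T" "closed_loop Q T s" "Psi (att s 0) (R_c Q s 0) < 1"
    "norm (tracking_error Q s 0) < sqrt \<eta>" for T s
  proof -
    let ?N = "(norm (tracking_error Q s 0))\<^sup>2"
    have "?N < (sqrt \<eta>)\<^sup>2" using that(4) by (intro power_strict_mono) auto
    then have N: "?N < \<eta>" using \<open>\<eta> > 0\<close> by simp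
    have "?N < \<psi>1" "?N < ex_max\<^sup>2" using N by (simp_all add: \<eta>_def)
    moreover have "(1 + 2 / ?L * k_R Q) * ?N < 2 / ?L * k_R Q * \<psi>1"
    proof -
      have "?N < 2 / ?L * k_R Q * \<psi>1 / (1 + 2 / ?L * k_R Q)" using N by (simp add: \<eta>_def)
      moreover have "0 < 1 + 2 / ?L * k_R Q" using gain_pos by (rule add_pos_pos[OF zero_less_one])
      ultimately show ?thesis by (subst mult.commute) (simp only: pos_less_divide_eq)
    qed
    moreover have "K * ?N < 1 / 2 * k_x Q * ex_max\<^sup>2"
    proof -
      have "?N < 1 / 2 * k_x Q * ex_max\<^sup>2 / K" using N by (simp add: \<eta>_def)
      then show ?thesis using K(1) by (subst mult.commute) (simp only: pos_less_divide_eq)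
    qed
    ultimately have "Psi (att s 0) (R_c Q s 0) < \<psi>1" "norm (e_x Q s 0) < ex_max"
      "(norm (e_Omega Q s 0))\<^sup>2 < 2 / ?L * k_R Q * (\<psi>1 - Psi (att s 0) (R_c Q s 0))"
      "lambda_max (M12 Q c1) * (norm (z1 Q s 0))\<^sup>2
        + lambda_max (M22' Q c2 \<psi>1) * (norm (z2 Q s 0))\<^sup>2 < 1 / 2 * k_x Q * ex_max\<^sup>2"
      by (rule tracking_solution.small_error_in_region[OF sol[OF that(2)] that(1) \<open>k_R Q > 0\<close> K
          that(3) \<open>ex_max > 0\<close>])+
    with that(3) show ?thesis by (intro CollectI conjI)
  qed
  \<comment> \<open>Closed-loop solutions starting in this neighbourhood start in the region of
    attraction, so the same two constants serve again.\<close>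
  have "exponentially_stable_from Q
      {s. Psi (att s 0) (R_c Q s 0) < 1 \<and> norm (tracking_error Q s 0) < sqrt \<eta>}"
    unfolding exponentially_stable_from_def
  proof (rule exI[of _ "sqrt (K / \<kappa>)"], rule exI[of _ "\<delta> / (2 * K)"], intro conjI ab allI impI)
    fix T s t
    assume "0 < T \<and> closed_loop Q T s \<and>
        s \<in> {s. Psi (att s 0) (R_c Q s 0) < 1 \<and> norm (tracking_error Q s 0) < sqrt \<eta>}"
      and t: "0 < t" "ereal t < T"
    then have sol_near: "0 < T" "closed_loop Q T s" "Psi (att s 0) (R_c Q s 0) < 1"
      "norm (tracking_error Q s 0) < sqrt \<eta>"
      by simp_all
    from sol_near(2) near[OF this] show "norm (tracking_error Q s t)
        \<le> sqrt (K / \<kappa>) * norm (tracking_error Q s 0) * exp (- (\<delta> / (2 * K)) * t)"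
      by (rule decay[OF _ _ t])
  qed
  moreover have "sqrt \<eta> > 0" using \<open>\<eta> > 0\<close> by simp
  ultimately show ?thesis
    unfolding zero_exponentially_stable_def using region by blast
qed

end
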